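(* Let $\mathbb{F}=\mathbb{R}$ or $\mathbb{C}$, let $n,m\in\mathbb{N}_+$ with $n>m$, and let $\Lambda=\mathrm{diag}(\lambda_1,\dots,\lambda_n)\in\mathbb{F}^{n\times n}$ with $|\lambda_1|>\dots>|\lambda_n|>0$. Assume $V\in\mathbb{F}^{n\times n}$ satisfies $VV^*=V^*V=I_n$ and define $A:=V\Lambda V^*$. Let $Y\in\mathbb{F}^{n\times m}$, define $X:=V^*Y$, and assume $X(1:m,:)$ is invertible and all entries of $X(m+1:n,:)X(1:m,:)^{-1}$ are nonzero. Then there exist $M_6=M_6(n,m,\Lambda,X)>0$, $M_7=M_7(n,m,\Lambda,X)>0$ and $k_7=k_7(n,m,\Lambda,X)\in\mathbb{N}_+$ such that for every $k\geq k_7$: (1) The $m$ Ritz values of $A$ projected on $\mathrm{span}(A^kY)$ have distinct moduli; denote them by $\{\theta_j\}_{j\in[m]}$ with $|\theta_1|>\dots>|\theta_m|$. (2) Let $W_k(:,j)$ be a unit Ritz vector corresponding to $\theta_j$. Then for every $j\in[m]$, \[ M_7\frac{|\lambda_{m+1}|^{2k}}{|\lambda_i|^k|\lambda_j|^k}\leq|V(:,i)^*W_k(:,j)|\leq M_6\frac{|\lambda_{m+1}|^{2k}}{|\lambda_i|^k|\lambda_j|^k},\quad i\in[m]\setminus\{j\}; \] \[ M_7\frac{|\lambda_i|^k}{|\lambda_j|^k}\leq|V(:,i)^*W_k(:,j)|\leq M_6\frac{|\lambda_i|^k}{|\lambda_j|^k},\quad i\in[n]\setminus[m]; \] \[ M_7\frac{|\lambda_{m+1}|^{2k}}{|\lambda_j|^{2k}}\leq1-|V(:,j)^*W_k(:,j)|\leq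 M_6\frac{|\lambda_{m+1}|^{2k}}{|\lambda_j|^{2k}}. \]
   Context: Notation: $[r]=\{1,\dots,r\}$. $M(:,j)$ is the $j$-th column of $M$, and $M(a:b,:)$ the submatrix of rows $a,\dots,b$. $M^*$ is the conjugate transpose (transpose if $\mathbb{F}=\mathbb{R}$). $\mathrm{span}(M)$ is the column space of $M$; here $\mathrm{span}(A^kY)$ has dimension $m$. For an $n\times n$ matrix $A$ and an $m$-dimensional subspace $\mathcal{S}\subseteq\mathbb{F}^n$ with basis matrix $\Phi\in\mathbb{F}^{n\times m}$ (columns a basis of $\mathcal{S}$), a Ritz pair of $A$ projected on $\mathcal{S}$ is $(\theta,z)$ with $z=\Phi y$, $y\ne0$ and $\Phi^*A\Phi y=\theta\,\Phi^*\Phi y$ (equivalently, when $\Phi=Q$ has orthonormal columns, $Q^*AQy=\theta y$); $\theta$ is a Ritz value and $z$ a Ritz vector. The $m$ Ritz values are counted with multiplicity. "Unit" refers to the Euclidean norm. *)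

theory Defs
  imports "Jordan_Normal_Form.Schur_Decomposition" "Jordan_Normal_Form.VS_Connect"
    "HOL-Analysis.L2_Norm"
begin

text \<open>
  The class \<open>real_or_complex\<close> stands for a scalar field that is either \<open>real\<close> or \<open>complex\<close>.
  Both types are instances, and lemma \<open>real_or_complex_embedding\<close> shows that, up to an isomorphism
  preserving norm and conjugation, there is no other instance.
\<close>

class real_or_complex = real_normed_field + conjugatable_field +
  assumes mult_conjugate_scaleR: "x * conjugate x = (norm x)\<^sup>2 *\<^sub>R 1"

instance real :: real_or_complex
  by standard (simp add: power2_eq_square)

instance complex :: real_or_complex
  by standard (simp add: complex_mult_cnj cmod_power2 complex_eq_iff)

lemma mult_conjugate: "x * conjugate x = (of_real ((norm x)\<^sup>2) :: 'a :: real_or_complex)"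
  by (simp only: mult_conjugate_scaleR of_real_def)

lemma conjugate_of_real: "conjugate (of_real r) = (of_real r :: 'a :: real_or_complex)"
proof (cases "r = 0")
  case False
  have "of_real r * conjugate (of_real r) = (of_real r * of_real r :: 'a)"
    using mult_conjugate[of "of_real r :: 'a"] by (simp add: power2_eq_square flip: of_real_mult)
  then show ?thesis using False by simp
qed simp

lemma add_conjugate_real: "\<exists>r. x + conjugate x = (of_real r :: 'a :: real_or_complex)"
proof
  have c1: "conjugate (1 :: 'a) = 1" using conjugate_of_real[of 1] by simp
  have "(x + 1) * conjugate (x + 1) = x * conjugate x + (x + conjugate x) + 1"
    by (simp add: conjugate_dist_add c1 algebra_simps)
  then have "x + conjugate x = of_real ((norm (x + 1))\<^sup>2) - of_real ((norm x)\<^sup>2) - 1"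
    by (simp add: mult_conjugate algebra_simps)
  then show "x + conjugate x = of_real ((norm (x + 1))\<^sup>2 - (norm x)\<^sup>2 - 1)" by simp
qed

lemma real_or_complex_embedding:
  obtains h :: "'a :: real_or_complex \<Rightarrow> complex"
  where "inj h" "range h = \<real> \<or> range h = UNIV"
    "\<And>x y. h (x + y) = h x + h y" "\<And>x y. h (x * y) = h x * h y" "\<And>r. h (of_real r) = of_real r"
    "\<And>x. h (conjugate x) = cnj (h x)" "\<And>x. norm (h x) = norm x"
proof -
  have self_conj: "\<exists>r. x = of_real r" if x: "conjugate x = x" for x :: 'a
  proof -
    obtain r where "x + conjugate x = of_real r" using add_conjugate_real by blast
    with x have "2 * x = of_real r" by simp
    then have "x = of_real (r / 2)" by (simp add: field_simps)
    then show ?thesis by blast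
  qed
  have norm_eq: "norm (h x) = norm x"
    if mult: "\<And>x y. h (x * y) = h x * h y" and re: "\<And>r. h (of_real r) = of_real r"
      and cj: "\<And>x. h (conjugate x) = cnj (h x)" for h :: "'a \<Rightarrow> complex" and x
  proof -
    have "complex_of_real ((norm (h x))\<^sup>2) = h x * cnj (h x)" by (rule complex_norm_square)
    also have "\<dots> = h (x * conjugate x)" by (simp add: mult cj)
    also have "\<dots> = of_real ((norm x)\<^sup>2)" by (simp only: mult_conjugate re)
    finally have "(norm (h x))\<^sup>2 = (norm x)\<^sup>2" using of_real_eq_iff by blast
    then show ?thesis by simp
  qed
  show thesis
  proof (cases "\<forall>x :: 'a. conjugate x = x")
    case True
    then have "\<forall>x :: 'a. \<exists>r. x = of_real r" using self_conj by blast
    from choice[OF this] obtain f :: "'a \<Rightarrow> real" where f: "\<And>x. x = of_real (f x)" by blast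
    have f': "f (of_real r) = r" for r using f[of "of_real r"] by simp
    have add: "f (x + y) = f x + f y" for x y
    proof -
      have "of_real (f (x + y)) = (of_real (f x + f y) :: 'a)"
        by (simp only: of_real_add flip: f)
      then show ?thesis by (simp only: of_real_eq_iff)
    qed
    have mult: "f (x * y) = f x * f y" for x y
    proof -
      have "of_real (f (x * y)) = (of_real (f x * f y) :: 'a)"
        by (simp only: of_real_mult flip: f)
      then show ?thesis by (simp only: of_real_eq_iff)
    qed
    let ?h = "\<lambda>x. complex_of_real (f x)"
    show thesis
    proof (rule that[of ?h])
      show "inj ?h"
      proof (rule injI)
        fix x y assume "?h x = ?h y"
        then have "f x = f y" by (simp only: of_real_eq_iff)
        then show "x = y" by (subst f[of x], subst f[of y]) (simp only:)
      qed
      have "\<exists>x. z = ?h x" if z: "z \<in> \<real>" for z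
        using z by (rule Reals_cases) (metis f')
      then show "range ?h = \<real> \<or> range ?h = UNIV" by auto
      show "norm (?h x) = norm x" for x
        by (rule norm_eq) (simp_all add: mult f' True)
    qed (simp_all add: add mult f' True)
  next
    case False
    then obtain x0 :: 'a where x0: "conjugate x0 \<noteq> x0" by blast
    define d where "d = x0 - conjugate x0"
    have cminus: "conjugate (x - y) = conjugate x - conjugate y" for x y :: 'a
      using conjugate_dist_add[of x "- y"] by (simp add: conjugate_neg)
    have cd: "conjugate d = - d" by (simp add: d_def cminus)
    have d0: "d \<noteq> 0" using x0 by (simp add: d_def)
    define i where "i = d * of_real (1 / norm d)"
    have ci: "conjugate i = - i"
      by (simp add: i_def conjugate_dist_mul conjugate_of_real cd del: of_real_divide)
    have "norm i = 1" using d0 by (simp add: i_def norm_mult norm_divide)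
    with mult_conjugate[of i] have ii: "i * i = - 1"
      by (simp add: ci) (metis minus_minus)
    have i0: "i \<noteq> 0" using \<open>norm i = 1\<close> by auto
    have expand: "\<exists>a b. x = of_real a + of_real b * i" for x
    proof -
      obtain a where a: "x + conjugate x = of_real a" using add_conjugate_real by blast
      define y where "y = - ((x - conjugate x) * i)"
      have "conjugate y = y"
        by (simp add: y_def cminus conjugate_dist_mul conjugate_neg ci algebra_simps)
      then obtain b where b: "y = of_real b" using self_conj by blast
      have "y * i = x - conjugate x" by (simp add: y_def mult.assoc ii)
      then have "of_real b * i = x - conjugate x" by (simp only: b)
      then have "2 * x = of_real a + of_real b * i" by (simp only: flip: a) simp
      then have "x = of_real (a / 2) + of_real (b / 2) * i" by (simp add: field_simps)
      then show ?thesis by blast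
    qed
    then have "\<forall>x. \<exists>p. x = of_real (fst p) + of_real (snd p) * i" by simp
    from choice[OF this] obtain p where p: "\<And>x. x = of_real (fst (p x)) + of_real (snd (p x)) * i"
      by blast
    define f g where "f x = fst (p x)" and "g x = snd (p x)" for x
    have fg: "x = of_real (f x) + of_real (g x) * i" for x unfolding f_def g_def by (rule p)
    have uniq: "a = a' \<and> b = b'" if e: "of_real a + of_real b * i = of_real a' + of_real b' * i" for a b a' b'
    proof -
      have "conjugate (of_real a + of_real b * i) = conjugate (of_real a' + of_real b' * i)"
        by (simp add: e)
      then have e': "of_real a - of_real b * i = of_real a' - of_real b' * i"
        by (simp add: conjugate_dist_add conjugate_dist_mul conjugate_of_real ci)
      have "2 * of_real a = (2 * of_real a' :: 'a)" using arg_cong2[OF e e', of "(+)"] by simp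
      then have "a = a'" by simp
      moreover from this have "b = b'" using e i0 by simp
      ultimately show ?thesis ..
    qed
    define h where "h x = Complex (f x) (g x)" for x
    have h: "h (of_real a + of_real b * i) = Complex a b" for a b
      using uniq[OF fg[of "of_real a + of_real b * i"]] by (simp add: h_def)
    have add: "h (x + y) = h x + h y" for x y
    proof -
      obtain a b c e where xy: "x = of_real a + of_real b * i" "y = of_real c + of_real e * i"
        using expand[of x] expand[of y] by blast
      have "x + y = of_real (a + c) + of_real (b + e) * i" by (simp add: xy algebra_simps)
      then show ?thesis by (simp only: h xy) (simp add: complex_eq_iff)
    qed
    have mult: "h (x * y) = h x * h y" for x y
    proof -
      obtain a b c e where xy: "x = of_real a + of_real b * i" "y = of_real c + of_real e * i"
        using expand[of x] expand[of y] by blast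
      have "x * y = of_real a * of_real c + of_real b * of_real e * (i * i)
        + (of_real a * of_real e + of_real b * of_real c) * i"
        unfolding xy by (simp only: distrib_left distrib_right ac_simps)
      also have "\<dots> = of_real (a * c - b * e) + of_real (a * e + b * c) * i"
        unfolding ii by simp
      finally show ?thesis by (simp only: h xy) (simp add: complex_eq_iff)
    qed
    have re: "h (of_real r) = of_real r" for r
      using h[of r 0] by (simp add: complex_of_real_def)
    have cj: "h (conjugate x) = cnj (h x)" for x
    proof -
      obtain a b where x: "x = of_real a + of_real b * i" using expand[of x] by blast
      have "conjugate x = of_real a + of_real (- b) * i"
        by (simp add: x conjugate_dist_add conjugate_dist_mul conjugate_of_real ci)
      then show ?thesis by (simp only: h x) (simp add: complex_eq_iff)
    qed
    show thesis
    proof (rule that[of h])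
      show "inj h"
      proof (rule injI)
        fix x y assume "h x = h y"
        then have "f x = f y" "g x = g y" by (simp_all add: h_def)
        then show "x = y" by (subst fg[of x], subst fg[of y]) (simp only:)
      qed
      have "z \<in> range h" for z using h[of "Re z" "Im z"] by (metis complex.collapse rangeI)
      then show "range h = \<real> \<or> range h = UNIV" by auto
    qed (simp_all add: add mult re cj norm_eq)
  qed
qed

definition l2_norm_vec :: "'a :: real_normed_vector vec \<Rightarrow> real" where
  "l2_norm_vec v = L2_set (\<lambda>i. norm (v $ i)) {..<dim_vec v}"

text \<open>Rows \<open>a, \<dots>, b - 1\<close> in the zero-based indexing of matrices.\<close>

definition row_block :: "'a mat \<Rightarrow> nat \<Rightarrow> nat \<Rightarrow> 'a mat" where
  "row_block B a b = mat (b - a) (dim_col B) (\<lambda>(i, j). B $$ (a + i, j))"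

definition basis_mat :: "nat \<Rightarrow> 'a :: field mat \<Rightarrow> 'a vec set \<Rightarrow> bool" where
  "basis_mat n \<Phi> S \<longleftrightarrow> dim_row \<Phi> = n \<and> distinct (cols \<Phi>) \<and>
     \<not> module.lin_dep class_ring (module_vec TYPE('a) n) (set (cols \<Phi>)) \<and>
     vec_space.col_space n \<Phi> = S"

definition ritz_pair :: "nat \<Rightarrow> 'a :: conjugatable_field mat \<Rightarrow> 'a vec set \<Rightarrow> 'a \<Rightarrow> 'a vec \<Rightarrow> bool" where
  "ritz_pair n A S \<theta> z \<longleftrightarrow> (\<exists>\<Phi> y. basis_mat n \<Phi> S \<and>
     y \<in> carrier_vec (dim_col \<Phi>) \<and> y \<noteq> 0\<^sub>v (dim_col \<Phi>) \<and> z = \<Phi> *\<^sub>v y \<and>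
     (mat_adjoint \<Phi> * A * \<Phi>) *\<^sub>v y = \<theta> \<cdot>\<^sub>v ((mat_adjoint \<Phi> * \<Phi>) *\<^sub>v y))"

text \<open>
  The characteristic polynomial, in the variable \<open>t\<close>, of the projected eigenproblem:
  \<open>det (\<Phi>\<^sup>* A \<Phi> - t \<Phi>\<^sup>* \<Phi>)\<close>. A different basis matrix of the same subspace changes it
  only by a nonzero constant factor, so its roots and their multiplicities depend on the subspace only.
\<close>

definition ritz_poly :: "'a :: conjugatable_field mat \<Rightarrow> 'a mat \<Rightarrow> 'a poly" where
  "ritz_poly A \<Phi> = det (map_mat (\<lambda>a. [:a:]) (mat_adjoint \<Phi> * A * \<Phi>)
     - [:0, 1:] \<cdot>\<^sub>m map_mat (\<lambda>a. [:a:]) (mat_adjoint \<Phi> * \<Phi>))"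

text \<open>
  Only roots in the scalar field count. Over \<open>real\<close>, a list \<open>\<theta>s\<close> of full length therefore means
  that all roots of the characteristic polynomial are real.
\<close>

definition ritz_values :: "nat \<Rightarrow> 'a :: conjugatable_field mat \<Rightarrow> 'a vec set \<Rightarrow> 'a list \<Rightarrow> bool" where
  "ritz_values n A S \<theta>s \<longleftrightarrow> (\<exists>\<Phi>. basis_mat n \<Phi> S \<and> mset \<theta>s = proots (ritz_poly A \<Phi>))"

end

theory Submission
  imports Defs "Jordan_Normal_Form.DL_Rank"
begin

text \<open>
  In eigenvector coordinates the subspace is spanned by the columns of a matrix \<open>Z\<close> with identity top
  block, whose remaining entries are of exact order \<open>|\<lambda>\<^sub>i|\<^sup>k / |\<lambda>\<^sub>b|\<^sup>k\<close>. The pencil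
  \<open>Z\<^sup>* (\<Lambda> - t) Z\<close> therefore converges to \<open>\<Lambda>\<^sub>1 - t\<close>, so that each \<open>\<lambda>\<^sub>j\<close> with \<open>j \<le> m\<close> attracts exactly
  one Ritz value. Row \<open>a\<close> of \<open>Z\<^sup>* (\<Lambda> - \<theta>\<^sub>j) Z y = 0\<close> reads
  \<open>(\<lambda>\<^sub>a - \<theta>\<^sub>j) y\<^sub>a = - \<Sum>\<^sub>b P\<^sub>a\<^sub>b y\<^sub>b\<close> with
  \<open>P\<^sub>a\<^sub>b = \<Sum>\<^sub>i\<^sub>>\<^sub>m Z\<^sub>i\<^sub>a\<^sup>* (\<lambda>\<^sub>i - \<theta>\<^sub>j) Z\<^sub>i\<^sub>b\<close>, which is of exact order
  \<open>|\<lambda>\<^sub>m\<^sub>+\<^sub>1|\<^sup>2\<^sup>k / (|\<lambda>\<^sub>a|\<^sup>k |\<lambda>\<^sub>b|\<^sup>k)\<close> because the term \<open>i = m + 1\<close> dominates. The \<open>y\<^sub>j\<close>-term on the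
  right dominates in turn; this gives the size of \<open>y\<^sub>a\<close>, then that of the other coordinates of the
  Ritz vector, and the normalisation gives \<open>1 - |y\<^sub>j|\<close>.
\<close>

section \<open>Components of a Ritz vector\<close>

lemma norm_conjugate [simp]: "norm (conjugate x) = norm (x :: 'a :: real_or_complex)"
proof -
  have "norm x * norm (conjugate x) = norm (of_real ((norm x)\<^sup>2) :: 'a)"
    by (simp only: mult_conjugate flip: norm_mult)
  then have "norm x * norm (conjugate x) = norm x * norm x"
    by (simp add: norm_mult power2_eq_square)
  then show ?thesis by (cases "x = 0") simp_all
qed

text \<open>Here \<open>d i\<close> is \<open>|\<lambda>\<^sub>i|\<^sup>k\<close>, the columns of \<open>Z\<close> are coordinates of a basis of the projection
  subspace with respect to the eigenvectors, and \<open>\<kappa>\<close> tends to \<open>0\<close> with growing \<open>k\<close>.\<close>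

locale perturbed_ritz_vector =
  fixes n m j :: nat and lam :: "nat \<Rightarrow> 'a :: real_or_complex" and \<theta> :: 'a
    and Z :: "nat \<Rightarrow> nat \<Rightarrow> 'a" and y :: "nat \<Rightarrow> 'a" and d :: "nat \<Rightarrow> real"
    and g h \<delta> R \<kappa> C K :: real
  assumes m_less_n: "m < n" and j_less: "j < m"
    and pos: "0 < g" "0 < h" "0 < \<delta>" "0 < R" "0 < \<kappa>"
    and d_pos: "\<And>i. i < n \<Longrightarrow> 0 < d i"
    and d_top: "\<And>a. a < m \<Longrightarrow> (d m)\<^sup>2 \<le> \<kappa> * (d a)\<^sup>2"
    and d_bot: "\<And>i. m < i \<Longrightarrow> i < n \<Longrightarrow> (d i)\<^sup>2 \<le> \<kappa> * (d m)\<^sup>2"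
    and Z_top: "\<And>a b. a < m \<Longrightarrow> b < m \<Longrightarrow> Z a b = (if a = b then 1 else 0)"
    and Z_lower: "\<And>i b. m \<le> i \<Longrightarrow> i < n \<Longrightarrow> b < m \<Longrightarrow> h * (d i / d b) \<le> norm (Z i b)"
    and Z_upper: "\<And>i b. m \<le> i \<Longrightarrow> i < n \<Longrightarrow> b < m \<Longrightarrow> norm (Z i b) \<le> g * (d i / d b)"
    and gap: "\<And>a. a \<le> m \<Longrightarrow> a \<noteq> j \<Longrightarrow> \<delta> \<le> norm (lam a - \<theta>)"
    and bound: "\<And>i. i < n \<Longrightarrow> norm (lam i - \<theta>) \<le> R"
    and galerkin: "\<And>a. a < m \<Longrightarrow>
      (\<Sum>i<n. conjugate (Z i a) * ((lam i - \<theta>) * (\<Sum>b<m. Z i b * y b))) = 0"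
    and unit: "(\<Sum>i<n. (norm (\<Sum>b<m. Z i b * y b))\<^sup>2) = 1"
    and C_def: "C = real n * g\<^sup>2 * R" and K_def: "K = 2 * C / \<delta>"
    and \<kappa>1: "\<kappa> \<le> 1"
    and small_C: "C * \<kappa> \<le> h\<^sup>2 * \<delta> / 2"
    and small_T: "real m * C * \<kappa> \<le> \<delta> / 2"
    and small_rest: "(real m * K\<^sup>2 + real n * (4 * g\<^sup>2)) * \<kappa> \<le> 2"
    and small_x: "real m * g * K * \<kappa> \<le> h / 4"
    and small_y: "real m * C * K * \<kappa> \<le> h\<^sup>2 * \<delta> / 8"
begin

section \<open>Eigenbasis coordinates of the Ritz vector, row equations and coupling sums\<close>

definition x :: "nat \<Rightarrow> 'a" where "x i = (\<Sum>b<m. Z i b * y b)"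

definition P :: "nat \<Rightarrow> nat \<Rightarrow> 'a" where
  "P a b = (\<Sum>i=m..<n. conjugate (Z i a) * ((lam i - \<theta>) * Z i b))"

text \<open>Weighted size of \<open>y\<close>: the estimates for \<open>P a b\<close> and
  \<open>Z i b\<close> both carry the factor \<open>1 / d b\<close>, so every row sum is controlled
  by this one number.\<close>

definition T :: real where "T = (\<Sum>b<m. norm (y b) / d b)"

lemma C_pos: "0 < C"
  unfolding C_def using m_less_n pos by simp

lemma d_posm: "a \<le> m \<Longrightarrow> 0 < d a"
  using d_pos m_less_n by simp

lemma x_top: "a < m \<Longrightarrow> x a = y a"
proof -
  assume a: "a < m"
  have "x a = (\<Sum>b<m. if b = a then y b else 0)"
    unfolding x_def by (rule sum.cong) (auto simp: Z_top a)
  then show ?thesis using a by simp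
qed

lemma split_n: "(\<Sum>i<n. f i) = (\<Sum>i<m. f i) + (\<Sum>i=m..<n. f i)" for f :: "nat \<Rightarrow> 'b :: comm_monoid_add"
  using sum.atLeastLessThan_concat[of 0 m n f] m_less_n by (simp add: atLeast0LessThan)

text \<open>Split the Galerkin sum at \<open>m\<close>. Above, the identity block of
  \<open>Z\<close> leaves only the term \<open>i = a\<close>; below, expanding \<open>x\<close> and
  exchanging the sums produces \<open>P\<close>.\<close>

lemma row_equation:
  assumes a: "a < m"
  shows "(lam a - \<theta>) * y a = - (\<Sum>b<m. P a b * y b)"
proof -
  have "0 = (\<Sum>i<n. conjugate (Z i a) * ((lam i - \<theta>) * x i))"
    using galerkin[OF a] by (simp add: x_def)
  also have "\<dots> = (\<Sum>i<m. conjugate (Z i a) * ((lam i - \<theta>) * x i))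
      + (\<Sum>i=m..<n. conjugate (Z i a) * ((lam i - \<theta>) * x i))"
    by (rule split_n)
  also have "(\<Sum>i<m. conjugate (Z i a) * ((lam i - \<theta>) * x i))
      = (\<Sum>i<m. if i = a then conjugate 1 * ((lam i - \<theta>) * y i) else 0)"
    by (rule sum.cong) (auto simp: Z_top a x_top)
  also have "\<dots> = (lam a - \<theta>) * y a"
    using a conjugate_of_real[of 1, where 'a = 'a] by simp
  also have "(\<Sum>i=m..<n. conjugate (Z i a) * ((lam i - \<theta>) * x i)) = (\<Sum>b<m. P a b * y b)"
    unfolding x_def P_def sum_distrib_left sum_distrib_right
    by (subst sum.swap) (simp add: mult.assoc)
  finally show ?thesis by (simp add: eq_neg_iff_add_eq_0)
qed

text \<open>The parameter \<open>s\<close> serves two uses: \<open>s = 1\<close> for all rows from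
  \<open>m\<close> on, and \<open>s = \<kappa>\<close> for the rows after \<open>m\<close>, which
  are small compared with row \<open>m\<close>.\<close>

lemma P_term:
  assumes "m \<le> i" "i < n" "a < m" "b < m" "(d i)\<^sup>2 \<le> s * (d m)\<^sup>2"
  shows "norm (conjugate (Z i a) * ((lam i - \<theta>) * Z i b)) \<le> g\<^sup>2 * R * s * ((d m)\<^sup>2 / (d a * d b))"
proof -
  have dab: "0 < d a" "0 < d b" "0 < d i" using assms d_pos m_less_n by auto
  have "norm (conjugate (Z i a) * ((lam i - \<theta>) * Z i b)) \<le> (g * (d i / d a)) * (R * (g * (d i / d b)))"
    unfolding norm_mult norm_conjugate
    using assms Z_upper[of i a] Z_upper[of i b] bound[of i] pos dab
    by (intro mult_mono mult_nonneg_nonneg) auto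
  also have "\<dots> = g\<^sup>2 * R * ((d i)\<^sup>2 / (d a * d b))"
    by (simp add: power2_eq_square)
  also have "\<dots> \<le> g\<^sup>2 * R * ((s * (d m)\<^sup>2) / (d a * d b))"
    using assms(5) pos dab by (intro mult_left_mono divide_right_mono) auto
  finally show ?thesis by (simp add: mult.assoc)
qed

lemma K_pos: "0 < K"
  unfolding K_def using C_pos pos by simp

lemma d_le: "m \<le> i \<Longrightarrow> i < n \<Longrightarrow> (d i)\<^sup>2 \<le> 1 * (d m)\<^sup>2"
  using d_bot[of i] mult_right_mono[OF \<kappa>1, of "(d m)\<^sup>2"] by (cases "i = m") auto

lemma P_upper:
  assumes a: "a < m" and b: "b < m"
  shows "norm (P a b) \<le> C * ((d m)\<^sup>2 / (d a * d b))"
proof -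
  have dab: "0 < d a" "0 < d b" using a b d_posm by auto
  have "norm (P a b) \<le> (\<Sum>i=m..<n. g\<^sup>2 * R * 1 * ((d m)\<^sup>2 / (d a * d b)))"
    unfolding P_def by (rule sum_norm_le, rule P_term) (use a b d_le in auto)
  also have "\<dots> = real (n - m) * (g\<^sup>2 * R * ((d m)\<^sup>2 / (d a * d b)))" by simp
  also have "\<dots> \<le> real n * (g\<^sup>2 * R * ((d m)\<^sup>2 / (d a * d b)))"
    using dab pos by (intro mult_right_mono) auto
  finally show ?thesis by (simp add: C_def mult.assoc)
qed

text \<open>The summand \<open>i = m\<close> has norm at least \<open>h^2 * \<delta> * e\<close>,
  with \<open>e\<close> the quotient of the \<open>d\<close>'s. All later summands carry the factor
  \<open>\<kappa>\<close>, so \<open>small_C\<close> lets them cancel at most half of it.\<close>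

lemma P_lower:
  assumes a: "a < m" and b: "b < m"
  shows "h\<^sup>2 * \<delta> / 2 * ((d m)\<^sup>2 / (d a * d b)) \<le> norm (P a b)"
proof -
  define e where "e = (d m)\<^sup>2 / (d a * d b)"
  let ?t = "\<lambda>i. conjugate (Z i a) * ((lam i - \<theta>) * Z i b)"
  have dab: "0 < d a" "0 < d b" "0 < d m" using a b d_posm by auto
  have e0: "0 \<le> e" unfolding e_def using dab by simp
  have P: "P a b = ?t m + (\<Sum>i=Suc m..<n. ?t i)"
    unfolding P_def using m_less_n by (simp add: sum.atLeast_Suc_lessThan)
  have "norm (\<Sum>i=Suc m..<n. ?t i) \<le> (\<Sum>i=Suc m..<n. g\<^sup>2 * R * \<kappa> * e)"
    unfolding e_def by (rule sum_norm_le, rule P_term) (use a b d_bot in auto)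
  also have "\<dots> = real (n - Suc m) * (g\<^sup>2 * R * \<kappa> * e)" by simp
  also have "\<dots> \<le> real n * (g\<^sup>2 * R * \<kappa> * e)"
    using e0 pos by (intro mult_right_mono) auto
  also have "\<dots> = C * \<kappa> * e" by (simp add: C_def)
  also have "\<dots> \<le> h\<^sup>2 * \<delta> / 2 * e" using small_C e0 by (rule mult_right_mono)
  finally have rest: "norm (\<Sum>i=Suc m..<n. ?t i) \<le> h\<^sup>2 * \<delta> / 2 * e" .
  have "h\<^sup>2 * \<delta> * e = (h * (d m / d a)) * (\<delta> * (h * (d m / d b)))"
    by (simp add: e_def power2_eq_square)
  also have "\<dots> \<le> norm (?t m)"
    unfolding norm_mult norm_conjugate
    using a b m_less_n j_less Z_lower[of m a] Z_lower[of m b] gap[of m] pos dab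
    by (intro mult_mono mult_nonneg_nonneg) auto
  also have "\<dots> \<le> norm (P a b) + norm (\<Sum>i=Suc m..<n. ?t i)"
    unfolding P using norm_diff_ineq[of "?t m" "\<Sum>i=Suc m..<n. ?t i"] by (simp only: diff_le_eq)
  also note rest
  finally have "h\<^sup>2 * \<delta> * e \<le> norm (P a b) + h\<^sup>2 * \<delta> / 2 * e" by simp
  then have "h\<^sup>2 * \<delta> / 2 * e \<le> norm (P a b)" by simp
  then show ?thesis unfolding e_def .
qed

section \<open>Dominance of the \<open>j\<close>-th coefficient\<close>

lemma T_nonneg: "0 \<le> T"
  unfolding T_def using d_posm by (intro sum_nonneg divide_nonneg_nonneg) (auto simp: less_imp_le)

text \<open>Solve row \<open>a\<close> for \<open>y a\<close>: the gap bounds the divisor from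
  below, and \<open>P_upper\<close> factors into a part depending on \<open>a\<close> and the
  weights collected in \<open>T\<close>.\<close>

lemma y_le_T:
  assumes a: "a < m" "a \<noteq> j"
  shows "norm (y a) \<le> C / \<delta> * ((d m)\<^sup>2 / d a) * T"
proof -
  have "\<delta> * norm (y a) \<le> norm (lam a - \<theta>) * norm (y a)"
    using gap[of a] a by (intro mult_right_mono) auto
  also have "\<dots> = norm (\<Sum>b<m. P a b * y b)"
    using row_equation[OF a(1)] by (simp flip: norm_mult)
  also have "\<dots> \<le> (\<Sum>b<m. C * ((d m)\<^sup>2 / (d a * d b)) * norm (y b))"
    by (rule sum_norm_le) (simp add: norm_mult mult_right_mono P_upper a del: times_divide_eq_right)
  also have "\<dots> = C * ((d m)\<^sup>2 / d a) * T"
    unfolding T_def sum_distrib_left by (rule sum.cong) auto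
  finally have "norm (y a) \<le> C * ((d m)\<^sup>2 / d a) * T / \<delta>"
    using pos by (simp only: pos_le_divide_eq mult.commute[of _ \<delta>])
  then show ?thesis by (simp add: mult_ac)
qed

text \<open>The rows with index other than \<open>j\<close> contribute only a small multiple of \<open>T\<close> to \<open>T\<close>, so the
  \<open>j\<close>-th summand dominates.\<close>

lemma T_upper: "T \<le> 2 * (norm (y j) / d j)"
proof -
  have "T = norm (y j) / d j + (\<Sum>b\<in>{..<m} - {j}. norm (y b) / d b)"
    unfolding T_def using j_less by (subst sum.remove[of _ j]) auto
  also have "(\<Sum>b\<in>{..<m} - {j}. norm (y b) / d b) \<le> (\<Sum>b\<in>{..<m} - {j}. C / \<delta> * \<kappa> * T)"
  proof (rule sum_mono)
    fix b assume b: "b \<in> {..<m} - {j}"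
    then have db: "0 < d b" using d_posm by auto
    have "norm (y b) / d b \<le> C / \<delta> * ((d m)\<^sup>2 / d b) * T / d b"
      using y_le_T[of b] b db by (intro divide_right_mono) auto
    also have "\<dots> = C / \<delta> * T * ((d m)\<^sup>2 / (d b)\<^sup>2)"
      by (simp add: power2_eq_square mult_ac)
    also have "\<dots> \<le> C / \<delta> * T * \<kappa>"
      using d_top[of b] b db C_pos pos T_nonneg
      by (intro mult_left_mono) (auto simp: pos_divide_le_eq)
    finally show "norm (y b) / d b \<le> C / \<delta> * \<kappa> * T" by (simp add: mult_ac)
  qed
  also have "\<dots> = real (card ({..<m} - {j})) * (C / \<delta> * \<kappa> * T)" by simp
  also have "\<dots> \<le> real m * (C / \<delta> * \<kappa> * T)"
    using C_pos pos T_nonneg j_less by (intro mult_right_mono) auto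
  also have "\<dots> = real m * C * \<kappa> / \<delta> * T" by simp
  \<comment> \<open>\<open>small_T\<close> makes the coefficient at most one half, so this part of
    \<open>T\<close> is absorbed on the left; hence the factor 2 in the claim.\<close>
  also have "\<dots> \<le> 1 / 2 * T"
    using small_T pos T_nonneg by (intro mult_right_mono) (auto simp: pos_divide_le_eq)
  finally show ?thesis by simp
qed

text \<open>Inserting \<open>T_upper\<close> into \<open>y_le_T\<close> leaves only the
  \<open>j\<close>-th coefficient; the two constants multiply to
  \<open>K = 2 * C / \<delta>\<close>.\<close>

lemma y_upper:
  assumes a: "a < m" "a \<noteq> j"
  shows "norm (y a) \<le> K * ((d m)\<^sup>2 / (d a * d j)) * norm (y j)"
proof -
  have "norm (y a) \<le> C / \<delta> * ((d m)\<^sup>2 / d a) * T" by (rule y_le_T) fact+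
  also have "\<dots> \<le> C / \<delta> * ((d m)\<^sup>2 / d a) * (2 * (norm (y j) / d j))"
    using T_upper C_pos pos d_posm[of a] a by (intro mult_left_mono) auto
  finally show ?thesis by (simp add: K_def mult_ac)
qed

lemma x_upper:
  assumes i: "m \<le> i" "i < n"
  shows "norm (x i) \<le> 2 * g * (d i / d j) * norm (y j)"
proof -
  have di: "0 < d i" using i d_pos by auto
  have "norm (x i) \<le> (\<Sum>b<m. g * (d i / d b) * norm (y b))"
    unfolding x_def
    by (rule sum_norm_le) (simp add: norm_mult mult_right_mono Z_upper i del: times_divide_eq_right)
  also have "\<dots> = g * d i * T"
    unfolding T_def sum_distrib_left by (rule sum.cong) auto
  also have "\<dots> \<le> g * d i * (2 * (norm (y j) / d j))"
    using T_upper pos di by (intro mult_left_mono) auto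
  finally show ?thesis by (simp add: mult_ac)
qed

section \<open>Normalisation and the mass outside the \<open>j\<close>-th eigendirection\<close>

lemma ratio_le: "a < m \<Longrightarrow> (d m)\<^sup>2 / (d a)\<^sup>2 \<le> \<kappa>"
  using d_top[of a] d_posm[of a] by (simp add: pos_divide_le_eq)

text \<open>Squared norm of the Ritz vector without its \<open>j\<close>-th component.\<close>

definition rest :: real where
  "rest = (\<Sum>a\<in>{..<m} - {j}. (norm (y a))\<^sup>2) + (\<Sum>i=m..<n. (norm (x i))\<^sup>2)"

lemma unit_split: "(norm (y j))\<^sup>2 + rest = 1"
proof -
  have "1 = (\<Sum>i<m. (norm (x i))\<^sup>2) + (\<Sum>i=m..<n. (norm (x i))\<^sup>2)"
    using unit by (simp add: split_n flip: x_def)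
  also have "(\<Sum>i<m. (norm (x i))\<^sup>2) = (\<Sum>i<m. (norm (y i))\<^sup>2)"
    by (simp add: x_top)
  also have "\<dots> = (norm (y j))\<^sup>2 + (\<Sum>a\<in>{..<m} - {j}. (norm (y a))\<^sup>2)"
    using j_less by (subst sum.remove[of _ j]) auto
  finally show ?thesis by (simp add: rest_def)
qed

text \<open>For \<open>a < m\<close> the square of \<open>y_upper\<close> has a surplus factor
  \<open>(d m / d a)^2\<close>, which is at most 1; for \<open>i\<close> from \<open>m\<close> on,
  \<open>d i\<close> is replaced by \<open>d m\<close>.\<close>

lemma rest_upper:
  "rest \<le> (real m * K\<^sup>2 + real n * (4 * g\<^sup>2)) * ((d m)\<^sup>2 / (d j)\<^sup>2) * (norm (y j))\<^sup>2"
proof -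
  define e where "e = (d m)\<^sup>2 / (d j)\<^sup>2 * (norm (y j))\<^sup>2"
  have e0: "0 \<le> e" by (simp add: e_def)
  have ya: "(norm (y a))\<^sup>2 \<le> K\<^sup>2 * e" if a: "a \<in> {..<m} - {j}" for a
  proof -
    have "(norm (y a))\<^sup>2 \<le> (K * ((d m)\<^sup>2 / (d a * d j)) * norm (y j))\<^sup>2"
      using y_upper[of a] a by (intro power_mono) auto
    also have "\<dots> = K\<^sup>2 * e * ((d m)\<^sup>2 / (d a)\<^sup>2)"
      by (simp add: e_def power2_eq_square mult_ac)
    also have "\<dots> \<le> K\<^sup>2 * e * 1"
      using ratio_le[of a] \<kappa>1 a e0 by (intro mult_left_mono) auto
    finally show ?thesis by simp
  qed
  have xi: "(norm (x i))\<^sup>2 \<le> 4 * g\<^sup>2 * e" if i: "i \<in> {m..<n}" for i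
  proof -
    have "(norm (x i))\<^sup>2 \<le> (2 * g * (d i / d j) * norm (y j))\<^sup>2"
      using x_upper[of i] i by (intro power_mono) auto
    also have "\<dots> = 4 * g\<^sup>2 * ((norm (y j))\<^sup>2 / (d j)\<^sup>2) * (d i)\<^sup>2"
      by (simp add: power2_eq_square mult_ac)
    also have "\<dots> \<le> 4 * g\<^sup>2 * ((norm (y j))\<^sup>2 / (d j)\<^sup>2) * (d m)\<^sup>2"
      using d_le[of i] i by (intro mult_left_mono) auto
    finally show ?thesis by (simp add: e_def mult_ac)
  qed
  have "rest \<le> (\<Sum>a\<in>{..<m} - {j}. K\<^sup>2 * e) + (\<Sum>i=m..<n. 4 * g\<^sup>2 * e)"
    unfolding rest_def using ya xi by (intro add_mono sum_mono)
  also have "\<dots> = real (card ({..<m} - {j})) * (K\<^sup>2 * e) + real (n - m) * (4 * g\<^sup>2 * e)" by simp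
  also have "\<dots> \<le> real m * (K\<^sup>2 * e) + real n * (4 * g\<^sup>2 * e)"
    using e0 j_less by (intro add_mono mult_right_mono) auto
  also have "\<dots> = (real m * K\<^sup>2 + real n * (4 * g\<^sup>2)) * e" by (simp add: algebra_simps)
  finally show ?thesis by (simp only: e_def mult.assoc)
qed

lemma rest_nonneg: "0 \<le> rest"
  unfolding rest_def by (intro add_nonneg_nonneg sum_nonneg) auto

lemma yj_le_1: "norm (y j) \<le> 1"
proof (rule power2_le_imp_le)
  show "(norm (y j))\<^sup>2 \<le> 1\<^sup>2" using unit_split rest_nonneg by simp
qed simp

text \<open>By \<open>small_rest\<close> the remaining mass is at most twice the square of the norm
  of \<open>y j\<close>, so that square is at least 1/3, hence above 1/4.\<close>

lemma yj_ge_half: "1 / 2 \<le> norm (y j)"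
proof -
  have "rest \<le> (real m * K\<^sup>2 + real n * (4 * g\<^sup>2)) * ((d m)\<^sup>2 / (d j)\<^sup>2) * (norm (y j))\<^sup>2"
    by (rule rest_upper)
  also have "\<dots> \<le> (real m * K\<^sup>2 + real n * (4 * g\<^sup>2)) * \<kappa> * (norm (y j))\<^sup>2"
    using ratio_le[OF j_less] by (intro mult_right_mono mult_left_mono) auto
  also have "\<dots> \<le> 2 * (norm (y j))\<^sup>2"
    using small_rest by (intro mult_right_mono) auto
  finally have "1 \<le> 3 * (norm (y j))\<^sup>2" using unit_split by simp
  then have "(1 / 2)\<^sup>2 \<le> (norm (y j))\<^sup>2" by (simp add: power2_eq_square)
  then show ?thesis by (rule power2_le_imp_le) simp
qed

section \<open>Two-sided bounds for the components\<close>

lemma y_upper':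
  assumes a: "a < m" "a \<noteq> j"
  shows "norm (y a) \<le> K * ((d m)\<^sup>2 / (d a * d j))"
proof -
  have "norm (y a) \<le> K * ((d m)\<^sup>2 / (d a * d j)) * norm (y j)" by (rule y_upper) fact+
  also have "\<dots> \<le> K * ((d m)\<^sup>2 / (d a * d j)) * 1"
    using yj_le_1 K_pos d_posm[of a] d_posm[of j] j_less a by (intro mult_left_mono) auto
  finally show ?thesis by simp
qed

text \<open>Shared by the rows of \<open>Z\<close> and of \<open>P\<close>. The weight
  \<open>1 / d b\<close> of the row and the bound on \<open>y b\<close> together contain
  \<open>(d m / d b)^2\<close>, which is at most \<open>\<kappa>\<close>; so everything off
  \<open>j\<close> is smaller by that factor.\<close>

lemma off_diagonal_sum:
  assumes "\<And>b. b < m \<Longrightarrow> norm (q b) \<le> c / d b" "0 \<le> c"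
  shows "norm (\<Sum>b\<in>{..<m} - {j}. q b * y b) \<le> real m * K * \<kappa> * (c / d j)"
proof -
  have dj: "0 < d j" using j_less d_posm by auto
  have "norm (\<Sum>b\<in>{..<m} - {j}. q b * y b) \<le> (\<Sum>b\<in>{..<m} - {j}. K * \<kappa> * (c / d j))"
  proof (rule sum_norm_le)
    fix b assume b: "b \<in> {..<m} - {j}"
    then have db: "0 < d b" using d_posm by auto
    have "norm (q b * y b) \<le> c / d b * (K * ((d m)\<^sup>2 / (d b * d j)))"
      unfolding norm_mult using assms y_upper' b db by (intro mult_mono) auto
    also have "\<dots> = K * (c / d j) * ((d m)\<^sup>2 / (d b)\<^sup>2)" by (simp add: power2_eq_square mult_ac)
    also have "\<dots> \<le> K * (c / d j) * \<kappa>"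
      using ratio_le[of b] b K_pos assms(2) dj by (intro mult_left_mono) auto
    finally show "norm (q b * y b) \<le> K * \<kappa> * (c / d j)" by (simp add: mult_ac)
  qed
  also have "\<dots> = real (card ({..<m} - {j})) * (K * \<kappa> * (c / d j))" by simp
  also have "\<dots> \<le> real m * (K * \<kappa> * (c / d j))"
    using K_pos pos assms(2) dj j_less by (intro mult_right_mono) auto
  finally show ?thesis by (simp add: mult.assoc)
qed

text \<open>The \<open>j\<close>-th term has norm at least \<open>l / 2\<close> because
  \<open>y j\<close> has norm at least one half, and the other terms total at most
  \<open>l / 4\<close>.\<close>

lemma dominant_term:
  assumes "\<And>b. b < m \<Longrightarrow> norm (q b) \<le> c / d b" "0 \<le> c" "l \<le> norm (q j)" "0 \<le> l"
    and "real m * K * \<kappa> * (c / d j) \<le> l / 4"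
  shows "l / 4 \<le> norm (\<Sum>b<m. q b * y b)"
proof -
  have "(\<Sum>b<m. q b * y b) = q j * y j + (\<Sum>b\<in>{..<m} - {j}. q b * y b)"
    using j_less by (subst sum.remove[of _ j]) auto
  then have "norm (q j * y j) - norm (\<Sum>b\<in>{..<m} - {j}. q b * y b) \<le> norm (\<Sum>b<m. q b * y b)"
    by (simp only: norm_diff_ineq)
  moreover have "l * (1 / 2) \<le> norm (q j * y j)"
    unfolding norm_mult using assms yj_ge_half by (intro mult_mono) auto
  moreover have "norm (\<Sum>b\<in>{..<m} - {j}. q b * y b) \<le> l / 4"
    using off_diagonal_sum[of q c, OF assms(1,2)] assms(5) by linarith
  ultimately show ?thesis by linarith
qed

lemma x_lower:
  assumes i: "m \<le> i" "i < n"
  shows "h / 4 * (d i / d j) \<le> norm (x i)"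
proof -
  have d0: "0 < d i" "0 < d j" using i d_pos d_posm[of j] j_less by auto
  have "h * (d i / d j) / 4 \<le> norm (\<Sum>b<m. Z i b * y b)"
  proof (rule dominant_term[where c = "g * d i"])
    have "real m * K * \<kappa> * (g * d i / d j) = (real m * g * K * \<kappa>) * (d i / d j)"
      by (simp add: mult_ac)
    also have "\<dots> \<le> h / 4 * (d i / d j)"
      using small_x d0 by (intro mult_right_mono) auto
    finally show "real m * K * \<kappa> * (g * d i / d j) \<le> h * (d i / d j) / 4" by simp
  qed (use i j_less Z_lower Z_upper pos d0 in auto)
  then show ?thesis by (simp add: x_def)
qed

text \<open>\<open>dominant_term\<close> applied to row \<open>a\<close> of \<open>P\<close> bounds
  the right side of the row equation from below; dividing by \<open>lam a - \<theta>\<close>, of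
  norm at most \<open>R\<close>, bounds \<open>y a\<close>. The 8 is the 2 of \<open>P_lower\<close>
  times the 4 of \<open>dominant_term\<close>.\<close>

lemma y_lower:
  assumes a: "a < m" "a \<noteq> j"
  shows "h\<^sup>2 * \<delta> / (8 * R) * ((d m)\<^sup>2 / (d a * d j)) \<le> norm (y a)"
proof -
  have d0: "0 < d a" "0 < d j" "0 < d m" using a d_posm j_less by auto
  have "h\<^sup>2 * \<delta> / 2 * ((d m)\<^sup>2 / (d a * d j)) / 4 \<le> norm (\<Sum>b<m. P a b * y b)"
  proof (rule dominant_term[where c = "C * ((d m)\<^sup>2 / d a)"])
    have "real m * K * \<kappa> * (C * ((d m)\<^sup>2 / d a) / d j) = (real m * C * K * \<kappa>) * ((d m)\<^sup>2 / (d a * d j))"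
      by (simp add: mult_ac)
    also have "\<dots> \<le> h\<^sup>2 * \<delta> / 8 * ((d m)\<^sup>2 / (d a * d j))"
      using small_y d0 by (intro mult_right_mono) auto
    finally show "real m * K * \<kappa> * (C * ((d m)\<^sup>2 / d a) / d j)
        \<le> h\<^sup>2 * \<delta> / 2 * ((d m)\<^sup>2 / (d a * d j)) / 4" by simp
    show "norm (P a b) \<le> C * ((d m)\<^sup>2 / d a) / d b" if "b < m" for b
      using P_upper[OF a(1) that] by simp
    show "h\<^sup>2 * \<delta> / 2 * ((d m)\<^sup>2 / (d a * d j)) \<le> norm (P a j)"
      using P_lower[OF a(1) j_less] .
  qed (use pos d0 C_pos in auto)
  also have "\<dots> = norm (lam a - \<theta>) * norm (y a)"
    using row_equation[OF a(1)] by (simp flip: norm_mult)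
  also have "\<dots> \<le> R * norm (y a)"
    using bound[of a] a m_less_n by (intro mult_right_mono) auto
  finally have "h\<^sup>2 * \<delta> / 2 * ((d m)\<^sup>2 / (d a * d j)) / 4 / R \<le> norm (y a)"
    using pos by (simp only: pos_divide_le_eq mult.commute[of _ R])
  then show ?thesis by (simp add: mult_ac)
qed

text \<open>As the norm of \<open>y j\<close> is at most 1, squaring it can only enlarge the defect,
  and the defect of the square is \<open>rest\<close>.\<close>

lemma yj_defect_upper: "1 - norm (y j) \<le> (real m * K\<^sup>2 + real n * (4 * g\<^sup>2)) * ((d m)\<^sup>2 / (d j)\<^sup>2)"
proof -
  let ?c = "(real m * K\<^sup>2 + real n * (4 * g\<^sup>2)) * ((d m)\<^sup>2 / (d j)\<^sup>2)"
  have "(norm (y j))\<^sup>2 \<le> norm (y j)"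
    using mult_left_mono[OF yj_le_1, of "norm (y j)"] by (simp add: power2_eq_square)
  then have "1 - norm (y j) \<le> rest" using unit_split by linarith
  also have "rest \<le> ?c * (norm (y j))\<^sup>2" by (rule rest_upper)
  also have "\<dots> \<le> ?c * 1"
    using yj_le_1 by (intro mult_left_mono) (auto simp: power_le_one)
  finally show ?thesis by simp
qed

text \<open>Component \<open>m\<close> alone already contributes the square of its lower bound to
  \<open>rest\<close>, and \<open>rest = (1 - t) * (1 + t)\<close> with \<open>t\<close> the norm of
  \<open>y j\<close> is at most twice the defect.\<close>

lemma yj_defect_lower: "h\<^sup>2 / 32 * ((d m)\<^sup>2 / (d j)\<^sup>2) \<le> 1 - norm (y j)"
proof -
  have "(h / 4 * (d m / d j))\<^sup>2 \<le> (norm (x m))\<^sup>2"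
    using x_lower[of m] m_less_n pos d_posm[of m] d_posm[of j] j_less by (intro power_mono) auto
  also have "\<dots> \<le> (\<Sum>i=m..<n. (norm (x i))\<^sup>2)"
    using m_less_n by (intro member_le_sum) auto
  also have "\<dots> \<le> rest"
    unfolding rest_def by (simp add: sum_nonneg)
  also have "rest = (1 - norm (y j)) * (1 + norm (y j))"
    using unit_split by (simp add: power2_eq_square algebra_simps)
  also have "\<dots> \<le> (1 - norm (y j)) * 2"
    using yj_le_1 by (intro mult_left_mono) auto
  finally show ?thesis by (simp add: power_mult_distrib power_divide)
qed

lemma x_upper':
  assumes i: "m \<le> i" "i < n"
  shows "norm (x i) \<le> 2 * g * (d i / d j)"
proof -
  have "norm (x i) \<le> 2 * g * (d i / d j) * norm (y j)" by (rule x_upper) fact+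
  also have "\<dots> \<le> 2 * g * (d i / d j) * 1"
    using yj_le_1 pos d_pos[of i] d_posm[of j] j_less i by (intro mult_left_mono) auto
  finally show ?thesis by simp
qed

end

section \<open>Roots of the Ritz polynomial\<close>

text \<open>Each disc of radius \<open>\<delta>\<close> around a \<open>c j\<close> contains a complex root, hence exactly one by counting.
  Over the reals the conjugate root lies in the same disc, which forces the root to be real.\<close>

lemma monic_split_near:
  fixes p :: "'a :: real_or_complex poly" and c :: "nat \<Rightarrow> 'a"
  assumes monic: "lead_coeff p = 1" and deg: "degree p = m" and \<delta>: "0 < \<delta>"
    and sep: "\<And>i j. i < m \<Longrightarrow> j < m \<Longrightarrow> i \<noteq> j \<Longrightarrow> 2 * \<delta> \<le> norm (c i - c j)"
    and small: "\<And>j. j < m \<Longrightarrow> norm (poly p (c j)) < \<delta> ^ m"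
  obtains \<theta> where "p = (\<Prod>j<m. [:- \<theta> j, 1:])" "\<And>j. j < m \<Longrightarrow> norm (c j - \<theta> j) < \<delta>"
proof -
  obtain h :: "'a \<Rightarrow> complex" where inj: "inj h" and range: "range h = \<real> \<or> range h = UNIV"
    and add: "\<And>x y. h (x + y) = h x + h y" and mult: "\<And>x y. h (x * y) = h x * h y"
    and re: "\<And>r. h (of_real r) = of_real r" and "\<And>x. h (conjugate x) = cnj (h x)"
    and nrm: "\<And>x. norm (h x) = norm x"
    by (rule real_or_complex_embedding[where 'a = 'a]) (rule that)
  interpret h: inj_idom_hom h
  proof
    show "h 0 = 0" "h 1 = 1" using re[of 0] re[of 1] by simp_all
    show "x = 0" if "h x = 0" for x using that nrm[of x] by simp
  qed (fact add mult)+
  interpret hp: map_poly_inj_idom_hom h ..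
  define q where "q = map_poly h p"
  have deg_q: "degree q = m" and monic_q: "coeff q (degree q) = 1"
    using monic deg by (simp_all add: q_def)
  from fundamental_theorem_algebra_factorized[of q] obtain as
    where q_as: "q = (\<Prod>a\<leftarrow>as. [:- a, 1:])" using monic_q by auto
  then have len: "length as = m" using deg_q by (simp add: degree_linear_factors)
  have root_q: "poly q z = 0 \<longleftrightarrow> z \<in> set as" for z
    unfolding q_as by (induction as) auto
  have norm_q: "norm (poly q z) = (\<Prod>a\<leftarrow>as. norm (z - a))" for z
    unfolding q_as
  proof (induction as)
    case (Cons a as)
    have "poly [:- a, 1:] z = z - a" by simp
    with Cons show ?case by (simp only: list.map prod_list.Cons poly_mult norm_mult)
  qed simp
  have dist_h: "norm (h x - h y) = norm (x - y)" for x y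
    using nrm[of "x - y"] by (simp add: h.hom_minus)
  \<comment> \<open>Otherwise all \<open>m\<close> factors of the polynomial at \<open>c j\<close>
    would have norm at least \<open>\<delta>\<close>, against \<open>small\<close>.\<close>
  have "\<exists>l<m. norm (h (c j) - as ! l) < \<delta>" if j: "j < m" for j
  proof (rule ccontr)
    assume "\<not> ?thesis"
    then have ge: "\<forall>a\<in>set as. \<delta> \<le> norm (h (c j) - a)"
      using len by (force simp: in_set_conv_nth)
    have "\<delta> ^ length as \<le> (\<Prod>a\<leftarrow>as. norm (h (c j) - a))"
      using ge \<delta> by (induction as) (auto intro!: mult_mono prod_list_nonneg)
    also have "\<dots> = norm (poly p (c j))"
      unfolding norm_q[symmetric] q_def using nrm by simp
    finally show False using small[OF j] len by simp
  qed
  then obtain s where s: "\<And>j. j < m \<Longrightarrow> s j < m" "\<And>j. j < m \<Longrightarrow> norm (h (c j) - as ! s j) < \<delta>"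
    by metis
  have close: "i = j" if "i < m" "j < m" "norm (h (c i) - a) < \<delta>" "norm (h (c j) - a) < \<delta>" for i j a
  proof (rule ccontr)
    assume "i \<noteq> j"
    then have "2 * \<delta> \<le> norm (h (c i) - h (c j))" using sep that dist_h by simp
    also have "\<dots> \<le> norm (h (c i) - a) + norm (h (c j) - a)"
      using norm_triangle_ineq4[of "h (c i) - a" "h (c j) - a"] by simp
    finally show False using that by simp
  qed
  \<comment> \<open>The discs are disjoint, so distinct centres select distinct positions in the
    root list; there are \<open>m\<close> of each, so every root, with multiplicity, is
    selected.\<close>
  have "inj_on s {..<m}"
    using close s(2) by (intro inj_onI) (metis lessThan_iff)
  then have bij: "bij_betw s {..<m} {..<m}"
    using s(1) by (intro bij_betw_imageI endo_inj_surj) auto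
  have in_range: "as ! s j \<in> range h" if j: "j < m" for j
  proof (cases "range h = UNIV")
    case False
    then have reals: "range h = \<real>" using range by simp
    let ?a = "as ! s j"
    have cnj_h: "cnj (h x) = h x" for x using reals by (metis Reals_cnj_iff rangeI)
    \<comment> \<open>\<open>q\<close> has real coefficients, so the conjugate of a root is a root,
      selected by some centre \<open>i\<close>. Since \<open>h (c j)\<close> is real, this conjugate
      is also close to it, which forces \<open>i = j\<close>.\<close>
    have "poly q (cnj ?a) = cnj (poly q ?a)"
      unfolding poly_altdef by (simp add: q_def cnj_h)
    also have "\<dots> = 0" using s(1)[OF j] root_q len by simp
    finally have "cnj ?a \<in> set as" by (simp add: root_q)
    then obtain l where l: "l < m" "cnj ?a = as ! l" using len by (metis in_set_conv_nth)
    then obtain i where i: "i < m" "l = s i"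
      using bij by (metis bij_betw_imp_surj_on imageE lessThan_iff)
    have "norm (h (c j) - cnj ?a) = norm (cnj (h (c j) - ?a))" by (simp add: cnj_h)
    also have "\<dots> < \<delta>" using s(2)[OF j] by (simp only: complex_mod_cnj)
    finally have "i = j" using close[of i j "cnj ?a"] s(2)[OF i(1)] i l j by simp
    then have "cnj ?a = ?a" using i l by simp
    then show ?thesis by (simp add: reals Reals_cnj_iff)
  qed simp
  define \<theta> where "\<theta> j = inv_into UNIV h (as ! s j)" for j
  have h\<theta>: "h (\<theta> j) = as ! s j" if "j < m" for j
    unfolding \<theta>_def using in_range[OF that] by (rule f_inv_into_f)
  have "q = (\<Prod>l<m. [:- (as ! l), 1:])"
    unfolding q_as prod.list_conv_set_nth by (simp add: len atLeast0LessThan)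
  also have "\<dots> = (\<Prod>j<m. [:- (as ! s j), 1:])"
    by (rule prod.reindex_bij_betw[OF bij, symmetric])
  also have "\<dots> = map_poly h (\<Prod>j<m. [:- \<theta> j, 1:])"
    unfolding hp.hom_prod by (rule prod.cong) (simp_all add: h\<theta> h.hom_uminus map_poly_pCons)
  finally have "p = (\<Prod>j<m. [:- \<theta> j, 1:])" by (simp add: q_def)
  moreover have "norm (c j - \<theta> j) < \<delta>" if "j < m" for j
    using s(2)[OF that] by (simp add: dist_h flip: h\<theta>[OF that])
  ultimately show thesis by (rule that)
qed

lemma proots_prod_linear:
  "proots (\<Prod>j<m. [:- \<theta> j, 1:] :: 'a :: field poly) = mset (map \<theta> [0..<m])"
proof (induction m)
  case (Suc m)
  have "(\<Prod>j<m. [:- \<theta> j, 1:]) \<noteq> 0" by simp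
  with Suc show ?case by (simp add: proots_mult del: mult_pCons_right)
qed simp

text \<open>With \<open>M\<close> the inverse of \<open>B\<close> times \<open>C\<close>, the pencil
  \<open>C - t B\<close> equals \<open>- B\<close> times \<open>t - M\<close>; so \<open>q\<close>
  is the characteristic polynomial of \<open>M\<close>. This supplies the monic polynomial needed
  for \<open>monic_split_near\<close>.\<close>

lemma monic_of_pencil:
  fixes B C :: "'a :: field mat"
  assumes B: "B \<in> carrier_mat m m" and C: "C \<in> carrier_mat m m" and det: "det B \<noteq> 0"
  obtains q where "lead_coeff q = 1" "degree q = m"
    "det (map_mat (\<lambda>a. [:a:]) C - [:0, 1:] \<cdot>\<^sub>m map_mat (\<lambda>a. [:a:]) B) = smult (det (- B)) q"
    "\<And>t. det (C - t \<cdot>\<^sub>m B) = det (- B) * poly q t"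
proof -
  interpret pc: comm_ring_hom "\<lambda>a :: 'a. [:a:]" by unfold_locales (auto simp: one_pCons)
  let ?p = "map_mat (\<lambda>a :: 'a. [:a:])"
  from det_non_zero_imp_unit[OF B det, of "()"] obtain D
    where D: "D \<in> carrier_mat m m" and BD: "B * D = 1\<^sub>m m"
    unfolding Units_def ring_mat_def by auto
  define M where "M = D * C"
  have M: "M \<in> carrier_mat m m" using D C by (simp add: M_def)
  have BM: "B * M = C"
    unfolding M_def using B C D by (simp add: assoc_mult_mat[of B m m D m C m, symmetric] BD)
  let ?pencil = "?p C - [:0, 1:] \<cdot>\<^sub>m ?p B"
  have "?p (- B) * char_poly_matrix M = ?p (- B) * ([:0, 1:] \<cdot>\<^sub>m 1\<^sub>m m) + ?p (- B) * ?p (- M)"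
  proof -
    have "map_mat (\<lambda>a. [:- a:]) M = ?p (- M)" using M by (intro eq_matI) auto
    then show ?thesis unfolding char_poly_matrix_def using B M
      by (simp add: mult_add_distrib_mat[of _ m m _ m])
  qed
  also have "?p (- B) * ?p (- M) = ?p ((- B) * (- M))"
    using B M by (intro pc.mat_hom_mult[symmetric]) auto
  also have "(- B) * (- M) = C" using B M BM by simp
  also have "?p (- B) * ([:0, 1:] \<cdot>\<^sub>m 1\<^sub>m m) = [:0, 1:] \<cdot>\<^sub>m ?p (- B)"
    using B by (simp add: mult_smult_distrib[of _ m m _ m])
  also have "[:0, 1:] \<cdot>\<^sub>m ?p (- B) + ?p C = ?pencil"
    using B C by (intro eq_matI) auto
  finally have "det ?pencil = det (?p (- B)) * char_poly M"
    using B M unfolding char_poly_def by (metis det_mult char_poly_matrix_closed map_carrier_mat uminus_carrier_mat)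
  then have pencil: "det ?pencil = smult (det (- B)) (char_poly M)"
    by (simp only: pc.hom_det) simp
  have "det (C - t \<cdot>\<^sub>m B) = det (- B) * poly (char_poly M) t" for t
  proof -
    have "poly (det ?pencil) t = det (C - t \<cdot>\<^sub>m B)"
      using B C by (intro poly_det_cong[of _ m]) auto
    then show ?thesis using pencil by simp
  qed
  with pencil degree_monic_char_poly[OF M] show thesis by (intro that[of "char_poly M"]) auto
qed

section \<open>Continuity of conjugation and determinants\<close>

lemma tendsto_conjugate:
  fixes f :: "nat \<Rightarrow> 'a :: real_or_complex"
  assumes "f \<longlonglongrightarrow> l"
  shows "(\<lambda>k. conjugate (f k)) \<longlonglongrightarrow> conjugate l"
proof -
  have "norm (conjugate x - conjugate y) = norm (x - y)" for x y :: 'a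
    using norm_conjugate[of "x - y"] conjugate_dist_add[of x "- y"]
    by (simp add: conjugate_neg del: norm_conjugate)
  then show ?thesis using assms by (simp add: tendsto_iff dist_norm)
qed

lemma tendsto_det:
  fixes M :: "nat \<Rightarrow> 'a :: real_normed_field mat"
  assumes "\<And>k. M k \<in> carrier_mat m m" "L \<in> carrier_mat m m"
    and "\<And>i j. i < m \<Longrightarrow> j < m \<Longrightarrow> (\<lambda>k. M k $$ (i, j)) \<longlonglongrightarrow> L $$ (i, j)"
  shows "(\<lambda>k. det (M k)) \<longlonglongrightarrow> det L"
  unfolding det_def'[OF assms(1)] det_def'[OF assms(2)]
  using assms(3) by (intro tendsto_sum tendsto_mult tendsto_const tendsto_prod) auto

section \<open>Projected eigenproblem in coordinates\<close>

lemma mat_adjoint_carrier: "A \<in> carrier_mat n m \<Longrightarrow> mat_adjoint A \<in> carrier_mat m n"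
  unfolding mat_adjoint_def by auto

lemma dim_mat_adjoint [simp]:
  "dim_row (mat_adjoint A) = dim_col A" "dim_col (mat_adjoint A) = dim_row A"
  unfolding mat_adjoint_def by auto

lemma index_mat_adjoint [simp]:
  "i < dim_col A \<Longrightarrow> j < dim_row A \<Longrightarrow> mat_adjoint A $$ (i, j) = conjugate (A $$ (j, i))"
  unfolding mat_adjoint_def by (simp add: mat_of_rows_def)

lemma mat_adjoint_mult:
  assumes "A \<in> carrier_mat n m" "B \<in> carrier_mat m l"
  shows "mat_adjoint (A * B) = mat_adjoint B * mat_adjoint A"
  by (rule eq_matI)
    (use assms in \<open>auto simp: scalar_prod_def sum_conjugate conjugate_dist_mul mult.commute\<close>)

lemma mat_diag_pow: "mat_diag n f ^\<^sub>m k = mat_diag n (\<lambda>i. f i ^ k)"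
proof (induction k)
  case 0
  show ?case by (simp add: mat_diag_def flip: mat_diag_one)
qed (simp add: power_commutes)

section \<open>Column spaces and basis matrices\<close>

lemma mem_col_space:
  assumes "M \<in> carrier_mat n c"
  shows "v \<in> vec_space.col_space n M \<longleftrightarrow> (\<exists>u \<in> carrier_vec c. v = M *\<^sub>v u)"
  using assms by (auto simp: vec_space.col_space_eq[OF assms])

lemma col_space_mult_subset:
  fixes M :: "'a :: field mat"
  assumes "M \<in> carrier_mat n c" "P \<in> carrier_mat c e"
  shows "vec_space.col_space n (M * P) \<subseteq> vec_space.col_space n M"
proof
  fix v assume "v \<in> vec_space.col_space n (M * P)"
  then obtain u where "u \<in> carrier_vec e" "v = M * P *\<^sub>v u"
    using mem_col_space[of "M * P" n e v] assms by auto
  then show "v \<in> vec_space.col_space n M"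
    using mem_col_space[of M n c v] assms by (auto intro!: bexI[of _ "P *\<^sub>v u"])
qed

text \<open>The columns of \<open>P\<close> are coefficient vectors of the columns of
  \<open>M'\<close>; used as the change of basis inside the projection subspace.\<close>

lemma col_space_subset_factor:
  fixes M :: "'a :: field mat"
  assumes M: "M \<in> carrier_mat n c" and M': "M' \<in> carrier_mat n e"
    and sub: "vec_space.col_space n M' \<subseteq> vec_space.col_space n M"
  obtains P where "P \<in> carrier_mat c e" "M' = M * P"
proof -
  have "\<exists>u \<in> carrier_vec c. col M' j = M *\<^sub>v u" if "j < e" for j
  proof -
    have "col M' j = M' *\<^sub>v unit_vec e j" using M' that by (intro eq_vecI) auto
    then have "col M' j \<in> vec_space.col_space n M'"
      using mem_col_space[OF M'] by auto
    then show ?thesis using sub mem_col_space[OF M] by auto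
  qed
  then obtain p where p: "\<And>j. j < e \<Longrightarrow> p j \<in> carrier_vec c" "\<And>j. j < e \<Longrightarrow> col M' j = M *\<^sub>v p j"
    by metis
  define P where "P = mat_of_cols c (map p [0..<e])"
  have P: "P \<in> carrier_mat c e" unfolding P_def using mat_of_cols_carrier(1)[of c "map p [0..<e]"] by simp
  have "M' = M * P"
  proof (rule mat_col_eqI)
    fix j assume "j < dim_col (M * P)"
    then have j: "j < e" using P by simp
    have "col P j = p j" using j p(1) by (simp add: P_def)
    then show "col M' j = col (M * P) j" using p(2)[OF j] col_mult2[OF M P j] by simp
  qed (use M M' P in auto)
  with P show thesis by (rule that)
qed

text \<open>A left inverse makes the matrix injective on vectors. Distinct columns are shown
  separately because linear dependence is a property of the set of columns.\<close>

lemma basis_mat_of_left_inverse: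
  fixes \<Phi> :: "'a :: field mat"
  assumes \<Phi>: "\<Phi> \<in> carrier_mat n m" and L: "L \<in> carrier_mat m n" and inv: "L * \<Phi> = 1\<^sub>m m"
  shows "basis_mat n \<Phi> (vec_space.col_space n \<Phi>)"
proof -
  interpret vec_space "TYPE('a)" n .
  have dist: "distinct (cols \<Phi>)"
    unfolding distinct_conv_nth
  proof (intro allI impI)
    fix i j assume "i < length (cols \<Phi>)" "j < length (cols \<Phi>)" and ij: "i \<noteq> j"
    then have i: "i < m" and j: "j < m" using \<Phi> by auto
    show "cols \<Phi> ! i \<noteq> cols \<Phi> ! j"
    proof
      assume "cols \<Phi> ! i = cols \<Phi> ! j"
      then have "L *\<^sub>v col \<Phi> i = L *\<^sub>v col \<Phi> j" using i j \<Phi> by simp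
      then have "col (L * \<Phi>) i = col (L * \<Phi>) j" by (simp only: col_mult2[OF L \<Phi> i] col_mult2[OF L \<Phi> j])
      then have "unit_vec m i = (unit_vec m j :: 'a vec)" unfolding inv using i j by simp
      then have "unit_vec m i $ i = (unit_vec m j $ i :: 'a)" by simp
      then show False using i j ij by simp
    qed
  qed
  have "\<not> lin_dep (set (cols \<Phi>))"
  proof
    assume "lin_dep (set (cols \<Phi>))"
    then obtain v where v: "v \<in> carrier_vec m" "v \<noteq> 0\<^sub>v m" "\<Phi> *\<^sub>v v = 0\<^sub>v n"
      using lin_depE[OF \<Phi> _ dist] by metis
    have "v = (L * \<Phi>) *\<^sub>v v" using v inv by simp
    also have "\<dots> = L *\<^sub>v (\<Phi> *\<^sub>v v)" by (rule assoc_mult_mat_vec[OF L \<Phi> v(1)])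
    also have "\<dots> = 0\<^sub>v m" using v L by (intro eq_vecI) auto
    finally show False using v(2) by simp
  qed
  with dist \<Phi> show ?thesis unfolding basis_mat_def by simp
qed

text \<open>\<open>ritz_pair\<close> hides an arbitrary basis matrix. Orthogonality of the residual
  to the subspace is the form of the condition that transfers to a prescribed one: if
  \<open>\<Psi> = \<Phi> * P\<close>, multiply by the adjoint of \<open>P\<close>.\<close>

lemma ritz_pair_residual:
  assumes A: "A \<in> carrier_mat n n" and \<Psi>: "\<Psi> \<in> carrier_mat n m"
    and ritz: "ritz_pair n A (vec_space.col_space n \<Psi>) \<theta> w"
  obtains y where "y \<in> carrier_vec m" "w = \<Psi> *\<^sub>v y"
    "mat_adjoint \<Psi> *\<^sub>v (A *\<^sub>v w - \<theta> \<cdot>\<^sub>v w) = 0\<^sub>v m"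
proof -
  obtain \<Phi> u where basis: "basis_mat n \<Phi> (vec_space.col_space n \<Psi>)" and u: "u \<in> carrier_vec (dim_col \<Phi>)"
    and w: "w = \<Phi> *\<^sub>v u"
    and eq: "(mat_adjoint \<Phi> * A * \<Phi>) *\<^sub>v u = \<theta> \<cdot>\<^sub>v ((mat_adjoint \<Phi> * \<Phi>) *\<^sub>v u)"
    using ritz unfolding ritz_pair_def by auto
  define c where "c = dim_col \<Phi>"
  have \<Phi>: "\<Phi> \<in> carrier_mat n c" and span: "vec_space.col_space n \<Phi> = vec_space.col_space n \<Psi>"
    using basis unfolding basis_mat_def c_def by auto
  note u = u[folded c_def]
  have \<Phi>': "mat_adjoint \<Phi> \<in> carrier_mat c n" using \<Phi> by (rule mat_adjoint_carrier)
  have wc: "w \<in> carrier_vec n" using w \<Phi> u by simp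
  have "mat_adjoint \<Phi> *\<^sub>v (A *\<^sub>v w - \<theta> \<cdot>\<^sub>v w)
      = mat_adjoint \<Phi> *\<^sub>v (A *\<^sub>v w) - mat_adjoint \<Phi> *\<^sub>v (\<theta> \<cdot>\<^sub>v w)"
    using \<Phi>' A wc by (intro mult_minus_distrib_mat_vec) auto
  also have "mat_adjoint \<Phi> *\<^sub>v (\<theta> \<cdot>\<^sub>v w) = \<theta> \<cdot>\<^sub>v ((mat_adjoint \<Phi> * \<Phi>) *\<^sub>v u)"
    using \<Phi>' \<Phi> u wc unfolding w by (simp add: mult_mat_vec[of _ c n])
  also have "mat_adjoint \<Phi> *\<^sub>v (A *\<^sub>v w) = (mat_adjoint \<Phi> * A * \<Phi>) *\<^sub>v u"
    using \<Phi>' A \<Phi> u unfolding w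
    by (simp add: assoc_mult_mat_vec[of _ c n _ c] assoc_mult_mat_vec[of _ c n _ n])
  finally have res: "mat_adjoint \<Phi> *\<^sub>v (A *\<^sub>v w - \<theta> \<cdot>\<^sub>v w) = 0\<^sub>v c"
    unfolding eq using \<Phi>' \<Phi> u by auto
  obtain P where P: "P \<in> carrier_mat c m" "\<Psi> = \<Phi> * P"
    using col_space_subset_factor[OF \<Phi> \<Psi>] span by auto
  have "mat_adjoint \<Psi> *\<^sub>v (A *\<^sub>v w - \<theta> \<cdot>\<^sub>v w) = mat_adjoint P *\<^sub>v (mat_adjoint \<Phi> *\<^sub>v (A *\<^sub>v w - \<theta> \<cdot>\<^sub>v w))"
    unfolding P(2) mat_adjoint_mult[OF \<Phi> P(1)]
    using mat_adjoint_carrier[OF P(1)] \<Phi>' A wc by (intro assoc_mult_mat_vec) auto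
  also have "\<dots> = 0\<^sub>v m"
    unfolding res using mat_adjoint_carrier[OF P(1)] P by (intro eq_vecI) auto
  finally have "mat_adjoint \<Psi> *\<^sub>v (A *\<^sub>v w - \<theta> \<cdot>\<^sub>v w) = 0\<^sub>v m" .
  moreover have "w \<in> vec_space.col_space n \<Psi>"
    using mem_col_space[OF \<Phi>] span w u by auto
  ultimately show thesis using that mem_col_space[OF \<Psi>] by auto
qed

section \<open>Passage to eigenbasis coordinates\<close>

lemma norm_sum_of_real:
  fixes f :: "nat \<Rightarrow> 'a :: real_or_complex"
  shows "of_real (\<Sum>i<n. (norm (f i))\<^sup>2) = (\<Sum>i<n. f i * conjugate (f i))"
  by (simp add: mult_conjugate)

text \<open>Multiplying by the adjoint of \<open>V\<close> sends \<open>w\<close> to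
  \<open>x = Z u\<close>, turns \<open>A\<close> into the diagonal matrix and preserves the norm.
  The entries of \<open>x\<close> are the products \<open>w \<bullet>c col V i\<close>.\<close>

lemma ritz_pair_coordinates:
  fixes V Z :: "'a :: real_or_complex mat"
  assumes V: "V \<in> carrier_mat n n" and VV: "mat_adjoint V * V = 1\<^sub>m n" and Z: "Z \<in> carrier_mat n m"
    and A: "A = V * mat_diag n lam * mat_adjoint V"
    and ritz: "ritz_pair n A (vec_space.col_space n (V * Z)) \<theta> w" and unit: "l2_norm_vec w = 1"
  obtains y where "\<And>i. i < n \<Longrightarrow> w \<bullet>c col V i = (\<Sum>b<m. Z $$ (i, b) * y b)"
    "\<And>a. a < m \<Longrightarrow> (\<Sum>i<n. conjugate (Z $$ (i, a)) * ((lam i - \<theta>) * (\<Sum>b<m. Z $$ (i, b) * y b))) = 0"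
    "(\<Sum>i<n. (norm (\<Sum>b<m. Z $$ (i, b) * y b))\<^sup>2) = 1"
proof -
  let ?\<Lambda> = "mat_diag n lam"
  have V': "mat_adjoint V \<in> carrier_mat n n" and Z': "mat_adjoint Z \<in> carrier_mat m n"
    using V Z by (simp_all add: mat_adjoint_carrier)
  have Ac: "A \<in> carrier_mat n n"
    unfolding A by (rule mult_carrier_mat[OF mult_carrier_mat[OF V mat_diag_dim] V'])
  have \<Psi>: "V * Z \<in> carrier_mat n m" by (rule mult_carrier_mat[OF V Z])
  obtain u where u: "u \<in> carrier_vec m" and w: "w = V * Z *\<^sub>v u"
    and res: "mat_adjoint (V * Z) *\<^sub>v (A *\<^sub>v w - \<theta> \<cdot>\<^sub>v w) = 0\<^sub>v m"
    using ritz_pair_residual[OF Ac \<Psi> ritz] by metis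
  define x where "x = Z *\<^sub>v u"
  have x: "x \<in> carrier_vec n" unfolding x_def using Z u by (rule mult_mat_vec_carrier)
  have wx: "w = V *\<^sub>v x" unfolding w x_def using V Z u by (rule assoc_mult_mat_vec)
  have wc: "w \<in> carrier_vec n" unfolding wx using V x by (rule mult_mat_vec_carrier)
  have Vw: "mat_adjoint V *\<^sub>v w = x"
    unfolding wx using assoc_mult_mat_vec[OF V' V x] VV x by simp
  have x_sum: "x $ i = (\<Sum>b<m. Z $$ (i, b) * u $ b)" if "i < n" for i
    using that Z u by (simp add: x_def scalar_prod_def atLeast0LessThan)
  have wV: "w \<bullet>c col V i = x $ i" if "i < n" for i
    using that V wc unfolding Vw[symmetric]
    by (simp add: scalar_prod_def mult.commute)
  have Aw: "A *\<^sub>v w = V *\<^sub>v (?\<Lambda> *\<^sub>v x)"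
    unfolding A
    by (simp only: assoc_mult_mat_vec[OF mult_carrier_mat[OF V mat_diag_dim] V' wc] Vw
        assoc_mult_mat_vec[OF V mat_diag_dim x])
  have \<Lambda>x: "?\<Lambda> *\<^sub>v x \<in> carrier_vec n" by (rule mult_mat_vec_carrier[OF mat_diag_dim x])
  have "mat_adjoint V *\<^sub>v (A *\<^sub>v w - \<theta> \<cdot>\<^sub>v w)
      = mat_adjoint V *\<^sub>v (A *\<^sub>v w) - mat_adjoint V *\<^sub>v (\<theta> \<cdot>\<^sub>v w)"
    using V' Ac wc by (intro mult_minus_distrib_mat_vec) auto
  also have "mat_adjoint V *\<^sub>v (\<theta> \<cdot>\<^sub>v w) = \<theta> \<cdot>\<^sub>v x"
    using mult_mat_vec[OF V' wc] Vw by simp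
  also have "mat_adjoint V *\<^sub>v (A *\<^sub>v w) = ?\<Lambda> *\<^sub>v x"
    unfolding Aw using assoc_mult_mat_vec[OF V' V \<Lambda>x] VV \<Lambda>x by simp
  finally have Vres: "mat_adjoint V *\<^sub>v (A *\<^sub>v w - \<theta> \<cdot>\<^sub>v w) = ?\<Lambda> *\<^sub>v x - \<theta> \<cdot>\<^sub>v x" .
  have "mat_adjoint Z *\<^sub>v (?\<Lambda> *\<^sub>v x - \<theta> \<cdot>\<^sub>v x) = mat_adjoint (V * Z) *\<^sub>v (A *\<^sub>v w - \<theta> \<cdot>\<^sub>v w)"
    unfolding mat_adjoint_mult[OF V Z] Vres[symmetric]
    using Z' V' Ac wc by (intro assoc_mult_mat_vec[symmetric]) auto
  then have galerkin: "mat_adjoint Z *\<^sub>v (?\<Lambda> *\<^sub>v x - \<theta> \<cdot>\<^sub>v x) = 0\<^sub>v m" using res by simp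
  have \<Lambda>x_i: "(?\<Lambda> *\<^sub>v x) $ i = lam i * x $ i" if "i < n" for i
  proof -
    have "(?\<Lambda> *\<^sub>v x) $ i = (\<Sum>l<n. (if i = l then lam l else 0) * x $ l)"
      using that x by (simp add: mat_diag_def scalar_prod_def atLeast0LessThan)
    also have "\<dots> = (\<Sum>l<n. if l = i then lam i * x $ i else 0)" by (rule sum.cong) auto
    finally show ?thesis using that by simp
  qed
  have row: "(\<Sum>i<n. conjugate (Z $$ (i, a)) * ((lam i - \<theta>) * x $ i)) = 0" if a: "a < m" for a
  proof -
    have "0 = (mat_adjoint Z *\<^sub>v (?\<Lambda> *\<^sub>v x - \<theta> \<cdot>\<^sub>v x)) $ a" using a galerkin by simp
    also have "\<dots> = (\<Sum>i<n. conjugate (Z $$ (i, a)) * (lam i * x $ i - \<theta> * x $ i))"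
      using a Z x \<Lambda>x \<Lambda>x_i by (simp add: scalar_prod_def atLeast0LessThan)
    finally show ?thesis by (simp add: left_diff_distrib)
  qed
  \<comment> \<open>Isometry via the adjoint: one copy of \<open>x\<close> is written as the adjoint
    of \<open>V\<close> applied to \<open>w\<close>, and \<open>V\<close> is moved to the other
    copy, where \<open>V x = w\<close>.\<close>
  have "(of_real (\<Sum>i<n. (norm (x $ i))\<^sup>2) :: 'a) = (\<Sum>i<n. x $ i * conjugate (\<Sum>l<n. conjugate (V $$ (l, i)) * w $ l))"
    unfolding norm_sum_of_real
    using V wc by (intro sum.cong refl) (simp add: Vw[symmetric] scalar_prod_def atLeast0LessThan)
  also have "\<dots> = (\<Sum>l<n. (\<Sum>i<n. V $$ (l, i) * x $ i) * conjugate (w $ l))"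
    by (simp add: sum_conjugate conjugate_dist_mul sum_distrib_left sum_distrib_right mult_ac)
      (rule sum.swap)
  also have "\<dots> = (\<Sum>l<n. w $ l * conjugate (w $ l))"
    using V x by (intro sum.cong refl) (simp add: wx scalar_prod_def atLeast0LessThan)
  also have "\<dots> = of_real (\<Sum>l<n. (norm (w $ l))\<^sup>2)" by (rule norm_sum_of_real[symmetric])
  finally have "(\<Sum>i<n. (norm (x $ i))\<^sup>2) = (\<Sum>l<n. (norm (w $ l))\<^sup>2)"
    by (simp only: of_real_eq_iff)
  also have "\<dots> = 1"
    using unit wc by (simp add: l2_norm_vec_def L2_set_def)
  finally have "(\<Sum>i<n. (norm (x $ i))\<^sup>2) = 1" .
  then show thesis using that[of "\<lambda>b. u $ b"] wV row x_sum by simp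
qed

text \<open>Removes \<open>V\<close> from the Ritz polynomial, so that the threshold for
  \<open>k\<close> can be chosen from \<open>Z\<close> alone, before \<open>V\<close> is
  given.\<close>

lemma galerkin_matrices:
  fixes V Z :: "'a :: real_or_complex mat"
  assumes V: "V \<in> carrier_mat n n" and VV: "mat_adjoint V * V = 1\<^sub>m n" and Z: "Z \<in> carrier_mat n m"
    and A: "A = V * mat_diag n lam * mat_adjoint V"
  shows "mat_adjoint (V * Z) * (V * Z) = mat_adjoint Z * Z"
    and "mat_adjoint (V * Z) * A * (V * Z) = mat_adjoint Z * mat_diag n lam * Z"
proof -
  let ?\<Lambda> = "mat_diag n lam" and ?V = "mat_adjoint V" and ?Z = "mat_adjoint Z"
  have V': "?V \<in> carrier_mat n n" and Z': "?Z \<in> carrier_mat m n"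
    using V Z by (simp_all add: mat_adjoint_carrier)
  have \<Lambda>: "?\<Lambda> \<in> carrier_mat n n" by simp
  have VZ: "V * Z \<in> carrier_mat n m" and \<Lambda>Z: "?\<Lambda> * Z \<in> carrier_mat n m"
    by (rule mult_carrier_mat[OF V Z], rule mult_carrier_mat[OF \<Lambda> Z])
  have Ac: "A \<in> carrier_mat n n"
    unfolding A by (rule mult_carrier_mat[OF mult_carrier_mat[OF V \<Lambda>] V'])
  have VVZ: "?V * (V * Z) = Z" using assoc_mult_mat[OF V' V Z] VV Z by simp
  have VVM: "?V * (V * M) = M" if "M \<in> carrier_mat n m" for M
    using assoc_mult_mat[OF V' V that] VV that by simp
  have "mat_adjoint (V * Z) * (V * Z) = ?Z * (?V * (V * Z))"
    unfolding mat_adjoint_mult[OF V Z] by (rule assoc_mult_mat[OF Z' V' VZ])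
  then show "mat_adjoint (V * Z) * (V * Z) = ?Z * Z" by (simp add: VVZ)
  have "mat_adjoint (V * Z) * A * (V * Z) = (?Z * ?V) * (A * (V * Z))"
    unfolding mat_adjoint_mult[OF V Z] by (rule assoc_mult_mat[OF mult_carrier_mat[OF Z' V'] Ac VZ])
  also have "A * (V * Z) = V * (?\<Lambda> * Z)"
    unfolding A
    by (simp only: assoc_mult_mat[OF mult_carrier_mat[OF V \<Lambda>] V' VZ] assoc_mult_mat[OF V \<Lambda> Z] VVZ)
  also have "(?Z * ?V) * (V * (?\<Lambda> * Z)) = ?Z * (?V * (V * (?\<Lambda> * Z)))"
    by (rule assoc_mult_mat[OF Z' V' mult_carrier_mat[OF V \<Lambda>Z]])
  also have "\<dots> = ?Z * (?\<Lambda> * Z)"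
    by (simp only: VVM[OF \<Lambda>Z])
  also have "\<dots> = ?Z * ?\<Lambda> * Z" by (rule assoc_mult_mat[OF Z' \<Lambda> Z, symmetric])
  finally show "mat_adjoint (V * Z) * A * (V * Z) = ?Z * ?\<Lambda> * Z" .
qed

section \<open>Asymptotics\<close>

text \<open>Monotonicity reduces both bounds to consecutive indices, of which there are finitely
  many. The factor 4 leaves room for perturbing each value by \<open>\<delta>\<close>.\<close>

lemma obtain_gap_and_ratio:
  fixes f :: "nat \<Rightarrow> real"
  assumes "1 < n" and dec: "\<And>i j. i < j \<Longrightarrow> j < n \<Longrightarrow> f j < f i" and pos: "0 < f (n - 1)"
  obtains \<delta> \<rho> where "\<And>i. i < n \<Longrightarrow> 0 < f i" "0 < \<delta>" "\<And>a b. a < b \<Longrightarrow> b < n \<Longrightarrow> 4 * \<delta> \<le> f a - f b"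
    "0 < \<rho>" "\<rho> < 1" "\<And>a b. a < b \<Longrightarrow> b < n \<Longrightarrow> f b \<le> \<rho> * f a"
proof -
  have fpos: "0 < f i" if "i < n" for i
  proof (cases "i = n - 1")
    case False
    then have "f (n - 1) < f i" using dec[of i "n - 1"] that by linarith
    then show ?thesis using pos by linarith
  qed (use pos in simp)
  have anti: "f b \<le> f (Suc a)" if "a < b" "b < n" for a b
    using dec[of "Suc a" b] that by (cases "Suc a = b") auto
  let ?I = "{..<n - 1}"
  have I: "finite ?I" "?I \<noteq> {}" using \<open>1 < n\<close> by (auto simp: lessThan_empty_iff bot_nat_def)
  define \<delta> where "\<delta> = Min ((\<lambda>a. (f a - f (Suc a)) / 4) ` ?I)"
  define \<rho> where "\<rho> = Max ((\<lambda>a. f (Suc a) / f a) ` ?I)"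
  note fpos
  moreover have "0 < \<delta>" unfolding \<delta>_def using I dec by (subst Min_gr_iff) auto
  moreover have "4 * \<delta> \<le> f a - f b" if "a < b" "b < n" for a b
  proof -
    have "\<delta> \<le> (f a - f (Suc a)) / 4" unfolding \<delta>_def using I that by (intro Min_le) auto
    then show ?thesis using anti[OF that] by simp
  qed
  moreover have "0 < \<rho>" unfolding \<rho>_def using I fpos by (subst Max_gr_iff) (auto intro!: bexI[of _ 0])
  moreover have "\<rho> < 1" unfolding \<rho>_def using I fpos dec by (subst Max_less_iff) auto
  moreover have "f b \<le> \<rho> * f a" if "a < b" "b < n" for a b
  proof -
    have "f (Suc a) / f a \<le> \<rho>" unfolding \<rho>_def using I that by (intro Max_ge) auto
    then have "f (Suc a) \<le> \<rho> * f a" using fpos[of a] that by (simp add: pos_divide_le_eq)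
    then show ?thesis using anti[OF that] by simp
  qed
  ultimately show thesis by (rule that)
qed

text \<open>The inserted 1 keeps minimum and maximum meaningful for empty \<open>S\<close>.\<close>

lemma obtain_two_sided_bound:
  fixes f :: "'b \<Rightarrow> real"
  assumes "finite S" "\<And>s. s \<in> S \<Longrightarrow> 0 < f s"
  obtains h g where "0 < h" "0 < g" "\<And>s. s \<in> S \<Longrightarrow> h \<le> f s" "\<And>s. s \<in> S \<Longrightarrow> f s \<le> g"
proof (rule that[of "Min (insert 1 (f ` S))" "Max (insert 1 (f ` S))"])
  show "0 < Min (insert 1 (f ` S))" using assms by (subst Min_gr_iff) auto
  show "0 < Max (insert 1 (f ` S))" using assms by (subst Max_gr_iff) auto
qed (use assms in auto)

text \<open>\<open>Z k\<close> tends to the embedding of the first \<open>m\<close> coordinates. So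
  the Gram matrix tends to the identity, and the pencil at \<open>lam j\<close> to a diagonal matrix
  whose \<open>j\<close>-th entry vanishes.\<close>

lemma det_galerkin_tendsto:
  fixes Z :: "nat \<Rightarrow> 'a :: real_or_complex mat"
  assumes Z: "\<And>k. Z k \<in> carrier_mat n m" and mn: "m < n"
    and lim: "\<And>i a. i < n \<Longrightarrow> a < m \<Longrightarrow> (\<lambda>k. Z k $$ (i, a)) \<longlonglongrightarrow> (if i = a then 1 else 0)"
  shows "(\<lambda>k. det (mat_adjoint (Z k) * Z k)) \<longlonglongrightarrow> 1"
    and "j < m \<Longrightarrow> (\<lambda>k. det (mat_adjoint (Z k) * mat_diag n lam * Z k
      - lam j \<cdot>\<^sub>m (mat_adjoint (Z k) * Z k))) \<longlonglongrightarrow> 0"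
proof -
  have c1: "conjugate (1 :: 'a) = 1" using conjugate_of_real[of 1] by simp
  \<comment> \<open>General weights \<open>c\<close> treat both limits at once: constant 1 for the
    Gram matrix, \<open>lam i - lam j\<close> for the pencil.\<close>
  have *: "(\<lambda>k. \<Sum>i<n. conjugate (Z k $$ (i, a)) * (c i * Z k $$ (i, b)))
      \<longlonglongrightarrow> (if a = b then c a else 0)" if ab: "a < m" "b < m" for a b c
  proof -
    have "(\<lambda>k. \<Sum>i<n. conjugate (Z k $$ (i, a)) * (c i * Z k $$ (i, b)))
      \<longlonglongrightarrow> (\<Sum>i<n. conjugate (if i = a then 1 else 0) * (c i * (if i = b then 1 else 0)))"
      using ab by (intro tendsto_sum tendsto_mult tendsto_const tendsto_conjugate lim) auto
    also have "(\<Sum>i<n. conjugate (if i = a then 1 else 0) * (c i * (if i = b then 1 else 0)))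
        = (\<Sum>i<n. if i = a then if a = b then c a else 0 else 0)"
      by (rule sum.cong) (auto simp: c1)
    also have "\<dots> = (if a = b then c a else 0)" using ab mn by simp
    finally show ?thesis .
  qed
  let ?B = "\<lambda>k. mat_adjoint (Z k) * Z k" and ?C = "\<lambda>k. mat_adjoint (Z k) * mat_diag n lam * Z k"
  have Z': "mat_adjoint (Z k) \<in> carrier_mat m n" for k using Z by (rule mat_adjoint_carrier)
  have B: "?B k \<in> carrier_mat m m" for k by (rule mult_carrier_mat[OF Z' Z])
  have C: "?C k \<in> carrier_mat m m" for k
    by (rule mult_carrier_mat[OF mult_carrier_mat[OF Z' mat_diag_dim] Z])
  have Bi: "?B k $$ (a, b) = (\<Sum>i<n. conjugate (Z k $$ (i, a)) * (1 * Z k $$ (i, b)))"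
    if "a < m" "b < m" for a b k
    using that carrier_matD[OF Z[of k]] by (simp add: scalar_prod_def atLeast0LessThan)
  have Ci: "?C k $$ (a, b) = (\<Sum>i<n. conjugate (Z k $$ (i, a)) * (lam i * Z k $$ (i, b)))"
    if "a < m" "b < m" for a b k
    using that carrier_matD[OF Z[of k]]
    by (simp add: mat_diag_mult_right[OF Z'] scalar_prod_def atLeast0LessThan mult.assoc)
  have "(\<lambda>k. det (?B k)) \<longlonglongrightarrow> det (1\<^sub>m m)"
  proof (rule tendsto_det[OF B])
    fix a b assume ab: "a < m" "b < m"
    show "(\<lambda>k. ?B k $$ (a, b)) \<longlonglongrightarrow> 1\<^sub>m m $$ (a, b)"
      unfolding Bi[OF ab] using *[OF ab, of "\<lambda>_. 1"] ab by simp
  qed simp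
  then show "(\<lambda>k. det (?B k)) \<longlonglongrightarrow> 1" by simp
  assume j: "j < m"
  let ?D = "mat_diag m (\<lambda>a. lam a - lam j)"
  have "(\<lambda>k. det (?C k - lam j \<cdot>\<^sub>m ?B k)) \<longlonglongrightarrow> det ?D"
  proof (rule tendsto_det)
    show "?C k - lam j \<cdot>\<^sub>m ?B k \<in> carrier_mat m m" for k
      using B by (intro minus_carrier_mat) simp
    fix a b assume ab: "a < m" "b < m"
    have entry: "(?C k - lam j \<cdot>\<^sub>m ?B k) $$ (a, b)
        = (\<Sum>i<n. conjugate (Z k $$ (i, a)) * ((lam i - lam j) * Z k $$ (i, b)))" for k
    proof -
      have "(?C k - lam j \<cdot>\<^sub>m ?B k) $$ (a, b) = ?C k $$ (a, b) - lam j * ?B k $$ (a, b)"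
        using ab carrier_matD[OF B[of k]] by (simp only: index_minus_mat index_smult_mat)
      also have "\<dots> = (\<Sum>i<n. conjugate (Z k $$ (i, a)) * (lam i * Z k $$ (i, b))
          - lam j * (conjugate (Z k $$ (i, a)) * (1 * Z k $$ (i, b))))"
        by (simp only: Bi[OF ab] Ci[OF ab] sum_distrib_left sum_subtractf)
      finally show ?thesis by (simp add: algebra_simps)
    qed
    have D_entry: "?D $$ (a, b) = (if a = b then lam a - lam j else 0)"
      using ab by (auto simp: mat_diag_def)
    show "(\<lambda>k. (?C k - lam j \<cdot>\<^sub>m ?B k) $$ (a, b)) \<longlonglongrightarrow> ?D $$ (a, b)"
      unfolding entry D_entry by (rule *[OF ab])
  qed simp
  moreover have "det ?D = 0"
  proof -
    have "det ?D = prod_list (diag_mat ?D)"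
      by (rule det_upper_triangular[of _ m]) (auto simp: mat_diag_def)
    also have "0 \<in> set (diag_mat ?D)" using j by (auto simp: diag_mat_def mat_diag_def intro!: image_eqI[of _ _ j])
    then have "prod_list (diag_mat ?D) = 0" by (simp add: prod_list_zero_iff)
    finally show ?thesis .
  qed
  ultimately show "(\<lambda>k. det (?C k - lam j \<cdot>\<^sub>m ?B k)) \<longlonglongrightarrow> 0" by simp
qed

text \<open>In the eigenbasis \<open>V\<close> the chosen basis has the coordinates \<open>Z = \<Lambda>\<^sup>k N \<Lambda>\<^sub>1\<^sup>-\<^sup>k\<close>, where
  \<open>N = X X\<^sub>1\<^sup>-\<^sup>1\<close> and \<open>\<Lambda>\<^sub>1\<close>, \<open>X\<^sub>1\<close> are the leading blocks; its top block is the identity.\<close>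

lemma col_space_power:
  fixes V :: "'a :: real_or_complex mat"
  assumes V: "V \<in> carrier_mat n n" and VV': "V * mat_adjoint V = 1\<^sub>m n" and VV: "mat_adjoint V * V = 1\<^sub>m n"
    and Y: "Y \<in> carrier_mat n m" and X: "X = mat_adjoint V * Y"
    and A: "A = V * mat_diag n lam * mat_adjoint V"
    and mn: "m < n" and lam0: "\<And>i. i < n \<Longrightarrow> lam i \<noteq> 0"
    and X1: "X1 \<in> carrier_mat m m" and X1inv: "X1inv \<in> carrier_mat m m" and inv: "X1inv * X1 = 1\<^sub>m m"
    and Z: "Z = mat n m (\<lambda>(i, a). (X * X1inv) $$ (i, a) * (lam i / lam a) ^ k)"
  shows "vec_space.col_space n (A ^\<^sub>m k * Y) = vec_space.col_space n (V * Z)"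
proof -
  let ?V = "mat_adjoint V" and ?\<Lambda> = "mat_diag n (\<lambda>i. lam i ^ k)"
  let ?D = "mat_diag m (\<lambda>a. inverse (lam a ^ k))" and ?D' = "mat_diag m (\<lambda>a. lam a ^ k)"
  have V': "?V \<in> carrier_mat n n" using V by (rule mat_adjoint_carrier)
  have Xc: "X \<in> carrier_mat n m" unfolding X by (rule mult_carrier_mat[OF V' Y])
  have \<Lambda>: "?\<Lambda> \<in> carrier_mat n n" and D: "?D \<in> carrier_mat m m" and D': "?D' \<in> carrier_mat m m" by simp_all
  have N: "X * X1inv \<in> carrier_mat n m" by (rule mult_carrier_mat[OF Xc X1inv])
  have "similar_mat_wit A (mat_diag n lam) V ?V"
    using mult_carrier_mat[OF mult_carrier_mat[OF V mat_diag_dim] V']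
    by (intro similar_mat_witI[OF VV' VV A]) (simp_all add: A V V')
  then have "A ^\<^sub>m k = V * ?\<Lambda> * ?V" by (simp only: similar_mat_wit_pow_id mat_diag_pow)
  then have M: "A ^\<^sub>m k * Y = V * (?\<Lambda> * X)"
    by (simp only: X assoc_mult_mat[OF mult_carrier_mat[OF V \<Lambda>] V' Y] assoc_mult_mat[OF V \<Lambda> mult_carrier_mat[OF V' Y]])
  have \<Lambda>X: "?\<Lambda> * X \<in> carrier_mat n m" by (rule mult_carrier_mat[OF \<Lambda> Xc])
  have M_carr: "A ^\<^sub>m k * Y \<in> carrier_mat n m" unfolding M by (rule mult_carrier_mat[OF V \<Lambda>X])
  have P: "X1inv * ?D \<in> carrier_mat m m" by (rule mult_carrier_mat[OF X1inv D])
  have "?\<Lambda> * X * (X1inv * ?D) = ?\<Lambda> * ((X * X1inv) * ?D)"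
    by (simp only: assoc_mult_mat[OF \<Lambda> Xc P] assoc_mult_mat[OF Xc X1inv D])
  also have "\<dots> = Z"
    unfolding mat_diag_mult_right[OF N] Z
    by (subst mat_diag_mult_left[of _ n m]) (auto simp: field_simps intro!: eq_matI)
  finally have Z_eq: "?\<Lambda> * X * (X1inv * ?D) = Z" .
  have VZ: "V * Z = A ^\<^sub>m k * Y * (X1inv * ?D)"
    unfolding M by (simp only: assoc_mult_mat[OF V \<Lambda>X P] Z_eq)
  \<comment> \<open>\<open>?D' * X1\<close> undoes the factor \<open>X1inv * ?D\<close>, which gives
    the opposite inclusion of column spaces.\<close>
  have Q: "?D' * X1 \<in> carrier_mat m m" by (rule mult_carrier_mat[OF D' X1])
  have DD: "?D * ?D' = 1\<^sub>m m"
    unfolding mat_diag_diag using lam0 mn by (auto simp: mat_diag_def intro!: eq_matI)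
  have "(X1inv * ?D) * (?D' * X1) = X1inv * ((?D * ?D') * X1)"
    by (simp only: assoc_mult_mat[OF X1inv D Q] assoc_mult_mat[OF D D' X1])
  also have "\<dots> = 1\<^sub>m m" using X1 inv by (simp only: DD left_mult_one_mat)
  finally have "V * Z * (?D' * X1) = A ^\<^sub>m k * Y"
    unfolding VZ using M_carr by (simp only: assoc_mult_mat[OF M_carr P Q] right_mult_one_mat)
  moreover have "V * Z \<in> carrier_mat n m" unfolding VZ by (rule mult_carrier_mat[OF M_carr P])
  ultimately show ?thesis
    using col_space_mult_subset[OF M_carr P] col_space_mult_subset[of "V * Z" n m "?D' * X1" m] Q VZ
    by (metis subset_antisym)
qed

(* Indices are zero-based: lam i, col V i and \<theta>s ! j stand for the objects numbered i + 1, j + 1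
   in one-based numbering; in particular lam m is lambda_(m+1). The constants are chosen before
   V and Y, so they depend only on n, m, lam and X. *)
theorem theorem3p2:
  fixes n m :: nat and lam :: "nat \<Rightarrow> 'a :: real_or_complex" and X X1inv :: "'a mat"
  assumes "0 < m" and "m < n"
    and "\<And>i j. i < j \<Longrightarrow> j < n \<Longrightarrow> norm (lam j) < norm (lam i)"
    and "0 < norm (lam (n - 1))"
    and "X \<in> carrier_mat n m"
    and "X1inv \<in> carrier_mat m m"
    and "inverts_mat (row_block X 0 m) X1inv" and "inverts_mat X1inv (row_block X 0 m)"
    and "\<And>i j. i < n - m \<Longrightarrow> j < m \<Longrightarrow> (row_block X m n * X1inv) $$ (i, j) \<noteq> 0"
  shows "\<exists>M6 > 0. \<exists>M7 > 0. \<exists>k7 > 0. \<forall>V Y.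
    V \<in> carrier_mat n n \<and> V * mat_adjoint V = 1\<^sub>m n \<and> mat_adjoint V * V = 1\<^sub>m n \<and>
    Y \<in> carrier_mat n m \<and> X = mat_adjoint V * Y \<longrightarrow>
    (\<forall>k \<ge> k7.
      let A = V * mat_diag n lam * mat_adjoint V;
          S = vec_space.col_space n ((A ^\<^sub>m k) * Y)
      in \<exists>\<theta>s. ritz_values n A S \<theta>s \<and> length \<theta>s = m \<and>
        (\<forall>i j. i < j \<and> j < m \<longrightarrow> norm (\<theta>s ! j) < norm (\<theta>s ! i)) \<and>
        (\<forall>j < m. \<forall>w. ritz_pair n A S (\<theta>s ! j) w \<and> l2_norm_vec w = 1 \<longrightarrow>
          (\<forall>i < m. i \<noteq> j \<longrightarrow>
            M7 * (norm (lam m) ^ (2 * k) / (norm (lam i) ^ k * norm (lam j) ^ k))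
              \<le> norm (w \<bullet>c col V i) \<and>
            norm (w \<bullet>c col V i)
              \<le> M6 * (norm (lam m) ^ (2 * k) / (norm (lam i) ^ k * norm (lam j) ^ k))) \<and>
          (\<forall>i. m \<le> i \<and> i < n \<longrightarrow>
            M7 * (norm (lam i) ^ k / norm (lam j) ^ k) \<le> norm (w \<bullet>c col V i) \<and>
            norm (w \<bullet>c col V i) \<le> M6 * (norm (lam i) ^ k / norm (lam j) ^ k)) \<and>
          M7 * (norm (lam m) ^ (2 * k) / norm (lam j) ^ (2 * k)) \<le> 1 - norm (w \<bullet>c col V j) \<and>
          1 - norm (w \<bullet>c col V j) \<le> M6 * (norm (lam m) ^ (2 * k) / norm (lam j) ^ (2 * k))))"
proof -
  let ?d = "\<lambda>k i. norm (lam i) ^ k"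
  define N where "N = X * X1inv"
  define Z where "Z k = mat n m (\<lambda>(i, a). N $$ (i, a) * (lam i / lam a) ^ k)" for k
  have "1 < n" using assms(1,2) by simp
  then obtain \<delta> \<rho> where lam_pos: "\<And>i. i < n \<Longrightarrow> 0 < norm (lam i)"
    and \<delta>: "0 < \<delta>" "\<And>a b. a < b \<Longrightarrow> b < n \<Longrightarrow> 4 * \<delta> \<le> norm (lam a) - norm (lam b)"
    and \<rho>: "0 < \<rho>" "\<rho> < 1" "\<And>a b. a < b \<Longrightarrow> b < n \<Longrightarrow> norm (lam b) \<le> \<rho> * norm (lam a)"
    using obtain_gap_and_ratio[of n "\<lambda>i. norm (lam i)", OF _ assms(3,4)] by metis
  have lam_nz: "lam i \<noteq> 0" if "i < n" for i using lam_pos[OF that] by auto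
  have N_top: "N $$ (a, b) = (if a = b then 1 else 0)" if "a < m" "b < m" for a b
  proof -
    have "N $$ (a, b) = (row_block X 0 m * X1inv) $$ (a, b)"
      using that assms by (simp add: N_def row_block_def scalar_prod_def)
    also have "row_block X 0 m * X1inv = 1\<^sub>m m"
      using assms(7) by (simp add: inverts_mat_def row_block_def)
    finally show ?thesis using that by simp
  qed
  have N_bot: "N $$ (i, b) \<noteq> 0" if "m \<le> i" "i < n" "b < m" for i b
  proof -
    have "N $$ (i, b) = (row_block X m n * X1inv) $$ (i - m, b)"
      using that assms by (simp add: N_def row_block_def scalar_prod_def)
    then show ?thesis using assms(9)[of "i - m" b] that by simp
  qed
  obtain h g where hg: "0 < h" "0 < g"
    and h: "\<And>s. s \<in> {m..<n} \<times> {..<m} \<Longrightarrow> h \<le> norm (N $$ s)"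
    and g: "\<And>s. s \<in> {m..<n} \<times> {..<m} \<Longrightarrow> norm (N $$ s) \<le> g"
  proof (rule obtain_two_sided_bound[of "{m..<n} \<times> {..<m}" "\<lambda>s. norm (N $$ s)"])
    show "0 < norm (N $$ s)" if "s \<in> {m..<n} \<times> {..<m}" for s using N_bot that by auto
  qed (simp, rule that)
  \<comment> \<open>Bounds every \<open>lam i - \<theta> j\<close>: both \<open>lam i\<close> and
    \<open>lam j\<close> have modulus at most that of \<open>lam 0\<close>, and
    \<open>\<theta> j\<close> lies within \<open>\<delta>\<close> of \<open>lam j\<close>.\<close>
  define R where "R = 2 * norm (lam 0) + \<delta>"
  define C where "C = real n * g\<^sup>2 * R"
  define K where "K = 2 * C / \<delta>"
  have Rpos: "0 < R" using \<delta> by (simp add: R_def add_nonneg_pos)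
  have Cpos: "0 < C" using Rpos hg assms(1,2) by (simp add: C_def)
  have Kpos: "0 < K" using Cpos \<delta> by (simp add: K_def)
  have Zc: "Z k \<in> carrier_mat n m" for k by (simp add: Z_def)
  have Z_top: "Z k $$ (a, b) = (if a = b then 1 else 0)" if "a < m" "b < m" for k a b
    using that assms(2) N_top[OF that] lam_nz[of a] by (auto simp: Z_def)
  have Z_norm: "norm (Z k $$ (i, b)) = norm (N $$ (i, b)) * (?d k i / ?d k b)" if "i < n" "b < m" for k i b
    using that by (simp add: Z_def norm_mult norm_divide norm_power power_divide)

  \<comment> \<open>All requirements on \<open>k\<close>: the smallness assumptions of the locale
    with \<open>\<kappa> = (\<rho>^2)^k\<close>, a nonsingular Gram matrix, and determinant
    estimates that become the hypothesis \<open>small\<close> of \<open>monic_split_near\<close>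
    after division by the Gram determinant.\<close>
  define ev where "ev k \<longleftrightarrow> (\<rho>\<^sup>2) ^ k \<le> 1
      \<and> C * (\<rho>\<^sup>2) ^ k \<le> h\<^sup>2 * \<delta> / 2 \<and> real m * C * (\<rho>\<^sup>2) ^ k \<le> \<delta> / 2
      \<and> (real m * K\<^sup>2 + real n * (4 * g\<^sup>2)) * (\<rho>\<^sup>2) ^ k \<le> 2
      \<and> real m * g * K * (\<rho>\<^sup>2) ^ k \<le> h / 4
      \<and> real m * C * K * (\<rho>\<^sup>2) ^ k \<le> h\<^sup>2 * \<delta> / 8
      \<and> det (mat_adjoint (Z k) * Z k) \<noteq> 0
      \<and> (\<forall>j\<in>{..<m}. norm (det (mat_adjoint (Z k) * mat_diag n lam * Z k
          - lam j \<cdot>\<^sub>m (mat_adjoint (Z k) * Z k))) < \<delta> ^ m * norm (det (mat_adjoint (Z k) * Z k)))" for k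
  have "\<forall>\<^sub>F k in sequentially. ev k"
  proof -
    have small: "\<forall>\<^sub>F k in sequentially. c * (\<rho>\<^sup>2) ^ k \<le> t" if "0 < t" for c t
    proof -
      have "norm (\<rho>\<^sup>2) < 1" using \<rho> by (simp add: power_less_one_iff)
      then have "(\<lambda>k. c * (\<rho>\<^sup>2) ^ k) \<longlonglongrightarrow> c * 0"
        by (intro tendsto_mult tendsto_const LIMSEQ_power_zero)
      then have "\<forall>\<^sub>F k in sequentially. c * (\<rho>\<^sup>2) ^ k < t" using that by (intro order_tendstoD) auto
      then show ?thesis by eventually_elim simp
    qed
    have lim: "(\<lambda>k. Z k $$ (i, a)) \<longlonglongrightarrow> (if i = a then 1 else 0)" if ia: "i < n" "a < m" for i a
    proof (cases "i < m")
      case True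
      then show ?thesis using Z_top ia by simp
    next
      case False
      have "norm (lam i / lam a) < 1"
        using assms(3)[of a i] ia False lam_pos[of a] assms(2) by (simp add: norm_divide)
      then have "(\<lambda>k. N $$ (i, a) * (lam i / lam a) ^ k) \<longlonglongrightarrow> N $$ (i, a) * 0"
        by (intro tendsto_mult tendsto_const LIMSEQ_power_zero)
      then show ?thesis using ia False by (simp add: Z_def)
    qed
    note det_lim = det_galerkin_tendsto[of Z n m, OF Zc assms(2) lim]
    have B: "(\<lambda>k. \<delta> ^ m * norm (det (mat_adjoint (Z k) * Z k))) \<longlonglongrightarrow> \<delta> ^ m * norm (1 :: 'a)"
      by (intro tendsto_mult tendsto_const tendsto_norm det_lim)
    have "\<forall>\<^sub>F k in sequentially. norm (det (mat_adjoint (Z k) * mat_diag n lam * Z k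
          - lam j \<cdot>\<^sub>m (mat_adjoint (Z k) * Z k))) < \<delta> ^ m * norm (det (mat_adjoint (Z k) * Z k))"
      if j: "j < m" for j
    proof -
      \<comment> \<open>\<open>\<delta> ^ m / 2\<close> separates the two sides: the left one tends
        to 0, the right one to \<open>\<delta> ^ m\<close>.\<close>
      have "0 < \<delta> ^ m / 2" using \<delta> by simp
      moreover have "(\<lambda>k. norm (det (mat_adjoint (Z k) * mat_diag n lam * Z k
          - lam j \<cdot>\<^sub>m (mat_adjoint (Z k) * Z k)))) \<longlonglongrightarrow> 0"
        using tendsto_norm[OF det_lim(2)[OF _ _ j, of lam]] by simp
      ultimately have "\<forall>\<^sub>F k in sequentially. norm (det (mat_adjoint (Z k) * mat_diag n lam * Z k
          - lam j \<cdot>\<^sub>m (mat_adjoint (Z k) * Z k))) < \<delta> ^ m / 2"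
        by (intro order_tendstoD)
      moreover have "\<forall>\<^sub>F k in sequentially. \<delta> ^ m / 2 < \<delta> ^ m * norm (det (mat_adjoint (Z k) * Z k))"
        using B \<delta> by (intro order_tendstoD) auto
      ultimately show ?thesis by eventually_elim simp
    qed
    moreover have "\<forall>\<^sub>F k in sequentially. det (mat_adjoint (Z k) * Z k) \<noteq> 0"
      by (rule tendsto_imp_eventually_ne[OF det_lim(1)]) simp_all
    ultimately show ?thesis
      unfolding ev_def using small[of 1 1] \<delta>(1) hg
      by (intro eventually_conj eventually_ball_finite small) auto
  qed
  then obtain k0 where k0: "\<And>k. k0 \<le> k \<Longrightarrow> ev k" by (auto simp: eventually_sequentially)

  \<comment> \<open>Each summand of \<open>M6\<close> is the constant of one upper bound, and each
    entry of the minimum \<open>M7\<close> that of one lower bound: components before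
    \<open>m\<close>, components from \<open>m\<close> on, defect.\<close>
  define M6 where "M6 = K + 2 * g + (real m * K\<^sup>2 + real n * (4 * g\<^sup>2))"
  define M7 where "M7 = min (h\<^sup>2 * \<delta> / (8 * R)) (min (h / 4) (h\<^sup>2 / 32))"
  have M6_ge: "K \<le> M6" "2 * g \<le> M6" "real m * K\<^sup>2 + real n * (4 * g\<^sup>2) \<le> M6" and M6pos: "0 < M6"
    using Kpos hg by (auto simp: M6_def intro!: add_pos_nonneg)
  have M7_le: "M7 \<le> h\<^sup>2 * \<delta> / (8 * R)" "M7 \<le> h / 4" "M7 \<le> h\<^sup>2 / 32" and M7pos: "0 < M7"
    using hg \<delta> Rpos by (auto simp: M7_def)
  have bounds: "\<exists>\<theta>s. ritz_values n A S \<theta>s \<and> length \<theta>s = m \<and>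
        (\<forall>i j. i < j \<and> j < m \<longrightarrow> norm (\<theta>s ! j) < norm (\<theta>s ! i)) \<and>
        (\<forall>j < m. \<forall>w. ritz_pair n A S (\<theta>s ! j) w \<and> l2_norm_vec w = 1 \<longrightarrow>
          (\<forall>i < m. i \<noteq> j \<longrightarrow>
            M7 * (norm (lam m) ^ (2 * k) / (norm (lam i) ^ k * norm (lam j) ^ k))
              \<le> norm (w \<bullet>c col V i) \<and>
            norm (w \<bullet>c col V i)
              \<le> M6 * (norm (lam m) ^ (2 * k) / (norm (lam i) ^ k * norm (lam j) ^ k))) \<and>
          (\<forall>i. m \<le> i \<and> i < n \<longrightarrow>
            M7 * (norm (lam i) ^ k / norm (lam j) ^ k) \<le> norm (w \<bullet>c col V i) \<and>
            norm (w \<bullet>c col V i) \<le> M6 * (norm (lam i) ^ k / norm (lam j) ^ k)) \<and>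
          M7 * (norm (lam m) ^ (2 * k) / norm (lam j) ^ (2 * k)) \<le> 1 - norm (w \<bullet>c col V j) \<and>
          1 - norm (w \<bullet>c col V j) \<le> M6 * (norm (lam m) ^ (2 * k) / norm (lam j) ^ (2 * k)))"
    if V: "V \<in> carrier_mat n n" and VV': "V * mat_adjoint V = 1\<^sub>m n" and VV: "mat_adjoint V * V = 1\<^sub>m n"
      and Y: "Y \<in> carrier_mat n m" and X: "X = mat_adjoint V * Y" and k: "Suc k0 \<le> k"
      and A: "A = V * mat_diag n lam * mat_adjoint V" and S: "S = vec_space.col_space n ((A ^\<^sub>m k) * Y)"
    for V Y k A S
  proof -
    have ev: "ev k" using k by (intro k0) simp
    have V': "mat_adjoint V \<in> carrier_mat n n" using V by (rule mat_adjoint_carrier)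
    have X1: "row_block X 0 m \<in> carrier_mat m m" using assms(5) by (simp add: row_block_def)
    have S_eq: "S = vec_space.col_space n (V * Z k)"
      unfolding S
    proof (rule col_space_power[OF V VV' VV Y X A assms(2) lam_nz X1 assms(6)])
      show "X1inv * row_block X 0 m = 1\<^sub>m m" using assms(6,8) by (simp add: inverts_mat_def)
      show "Z k = mat n m (\<lambda>(i, a). (X * X1inv) $$ (i, a) * (lam i / lam a) ^ k)"
        unfolding Z_def N_def ..
    qed
    let ?B = "mat_adjoint (Z k) * Z k" and ?C = "mat_adjoint (Z k) * mat_diag n lam * Z k"
    have Z': "mat_adjoint (Z k) \<in> carrier_mat m n" using Zc by (rule mat_adjoint_carrier)
    have Bc: "?B \<in> carrier_mat m m" by (rule mult_carrier_mat[OF Z' Zc])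
    have Cc: "?C \<in> carrier_mat m m" by (rule mult_carrier_mat[OF mult_carrier_mat[OF Z' mat_diag_dim] Zc])
    have detB: "det ?B \<noteq> 0" using ev by (simp add: ev_def)
    obtain q where q: "lead_coeff q = 1" "degree q = m"
      and pencil: "det (map_mat (\<lambda>a. [:a:]) ?C - [:0, 1:] \<cdot>\<^sub>m map_mat (\<lambda>a. [:a:]) ?B) = smult (det (- ?B)) q"
      and q_eval: "\<And>t. det (?C - t \<cdot>\<^sub>m ?B) = det (- ?B) * poly q t"
      using monic_of_pencil[OF Bc Cc detB] by metis
    have det_minus: "norm (det (- ?B)) = norm (det ?B)"
    proof -
      have "- ?B = (- 1) \<cdot>\<^sub>m ?B" by (rule eq_matI) auto
      then have "det (- ?B) = (- 1) ^ m * det ?B"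
        by (simp only: det_smult carrier_matD(2)[OF Bc])
      then show ?thesis by (simp add: norm_mult norm_power)
    qed
    have gapn: "4 * \<delta> \<le> norm (lam i - lam j)" if "i < n" "j < n" "i \<noteq> j" for i j
    proof (cases "i < j")
      case True
      then show ?thesis using \<delta>(2)[of i j] that norm_triangle_ineq2[of "lam i" "lam j"] by linarith
    next
      case False
      then show ?thesis using \<delta>(2)[of j i] that norm_triangle_ineq2[of "lam j" "lam i"]
        by (simp add: norm_minus_commute)
    qed
    \<comment> \<open>The centres are the \<open>lam j\<close>; the value of \<open>q\<close> there
      is, up to sign, the quotient of the two determinants estimated in \<open>ev\<close>.\<close>
    obtain \<theta> where q_prod: "q = (\<Prod>j<m. [:- \<theta> j, 1:])" and \<theta>: "\<And>j. j < m \<Longrightarrow> norm (lam j - \<theta> j) < \<delta>"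
    proof (rule monic_split_near[OF q \<delta>(1)])
      show "2 * \<delta> \<le> norm (lam i - lam j)" if "i < m" "j < m" "i \<noteq> j" for i j
        using gapn[of i j] that assms(2) \<delta>(1) by simp
      fix j assume j: "j < m"
      have "norm (det ?B) * norm (poly q (lam j)) = norm (det (?C - lam j \<cdot>\<^sub>m ?B))"
        using q_eval[of "lam j"] by (simp add: norm_mult det_minus)
      also have "\<dots> < norm (det ?B) * \<delta> ^ m"
        using ev j unfolding ev_def by (simp add: mult.commute)
      finally show "norm (poly q (lam j)) < \<delta> ^ m" by (simp add: mult_less_cancel_left)
    qed (rule that)
    define \<theta>s where "\<theta>s = map \<theta> [0..<m]"
    have len: "length \<theta>s = m" and nth: "\<And>j. j < m \<Longrightarrow> \<theta>s ! j = \<theta> j" by (simp_all add: \<theta>s_def)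
    have mod_lower: "norm (lam j) - \<delta> < norm (\<theta> j)" and mod_upper: "norm (\<theta> j) < norm (lam j) + \<delta>"
      if "j < m" for j
      using \<theta>[OF that] norm_triangle_ineq2[of "lam j" "\<theta> j"] norm_triangle_ineq3[of "lam j" "\<theta> j"] by linarith+
    have basis: "basis_mat n (V * Z k) S"
      unfolding S_eq
    proof (rule basis_mat_of_left_inverse)
      \<comment> \<open>Truncation to the first \<open>m\<close> coordinates: after the adjoint of
        \<open>V\<close> it inverts \<open>V * Z k\<close>, whose coordinate matrix has the identity
        as top block.\<close>
      let ?W = "mat m n (\<lambda>(a, i). if a = i then 1 else 0 :: 'a)"
      have W: "?W \<in> carrier_mat m n" by simp
      show "V * Z k \<in> carrier_mat n m" by (rule mult_carrier_mat[OF V Zc])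
      show "?W * mat_adjoint V \<in> carrier_mat m n" by (rule mult_carrier_mat[OF W V'])
      have "?W * mat_adjoint V * (V * Z k) = ?W * (mat_adjoint V * V * Z k)"
        by (simp only: assoc_mult_mat[OF W V' mult_carrier_mat[OF V Zc]] assoc_mult_mat[OF V' V Zc])
      also have "\<dots> = ?W * Z k" by (simp only: VV left_mult_one_mat[OF Zc])
      also have "\<dots> = 1\<^sub>m m"
      proof (rule eq_matI)
        fix a b assume ab: "a < dim_row (1\<^sub>m m :: 'a mat)" "b < dim_col (1\<^sub>m m :: 'a mat)"
        have "(?W * Z k) $$ (a, b) = (\<Sum>i<n. (if a = i then 1 else 0) * Z k $$ (i, b))"
          using ab carrier_matD[OF Zc[of k]] by (simp add: scalar_prod_def atLeast0LessThan)
        also have "\<dots> = (\<Sum>i<n. if i = a then Z k $$ (a, b) else 0)" by (rule sum.cong) auto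
        finally show "(?W * Z k) $$ (a, b) = 1\<^sub>m m $$ (a, b)" using ab assms(2) Z_top by simp
      qed (use carrier_matD[OF Zc[of k]] in auto)
      finally show "?W * mat_adjoint V * (V * Z k) = 1\<^sub>m m" .
    qed
    have "det (- ?B) \<noteq> 0" using det_minus detB by (metis norm_eq_zero)
    then have "proots (ritz_poly A (V * Z k)) = mset \<theta>s"
      unfolding ritz_poly_def galerkin_matrices[OF V VV Zc A] pencil
      by (simp add: q_prod proots_prod_linear \<theta>s_def del: mset_map)
    then have ritz: "ritz_values n A S \<theta>s" unfolding ritz_values_def using basis by auto
    \<comment> \<open>Each modulus moves by less than \<open>\<delta>\<close> while neighbouring
      moduli of \<open>lam\<close> differ by at least \<open>4 * \<delta>\<close>, so the order is
      kept.\<close>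
    have decreasing: "norm (\<theta>s ! j) < norm (\<theta>s ! i)" if "i < j" "j < m" for i j
      using mod_lower[of i] mod_upper[of j] \<delta>(2)[of i j] that assms(2) \<delta>(1) by (simp add: nth)
    have "(\<forall>i < m. i \<noteq> j \<longrightarrow>
            M7 * (norm (lam m) ^ (2 * k) / (norm (lam i) ^ k * norm (lam j) ^ k))
              \<le> norm (w \<bullet>c col V i) \<and>
            norm (w \<bullet>c col V i)
              \<le> M6 * (norm (lam m) ^ (2 * k) / (norm (lam i) ^ k * norm (lam j) ^ k))) \<and>
          (\<forall>i. m \<le> i \<and> i < n \<longrightarrow>
            M7 * (norm (lam i) ^ k / norm (lam j) ^ k) \<le> norm (w \<bullet>c col V i) \<and>
            norm (w \<bullet>c col V i) \<le> M6 * (norm (lam i) ^ k / norm (lam j) ^ k)) \<and>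
          M7 * (norm (lam m) ^ (2 * k) / norm (lam j) ^ (2 * k)) \<le> 1 - norm (w \<bullet>c col V j) \<and>
          1 - norm (w \<bullet>c col V j) \<le> M6 * (norm (lam m) ^ (2 * k) / norm (lam j) ^ (2 * k))"
      if j: "j < m" and pair: "ritz_pair n A S (\<theta>s ! j) w" and unit: "l2_norm_vec w = 1" for j w
    proof -
      obtain y where y: "\<And>i. i < n \<Longrightarrow> w \<bullet>c col V i = (\<Sum>b<m. Z k $$ (i, b) * y b)"
        "\<And>a. a < m \<Longrightarrow> (\<Sum>i<n. conjugate (Z k $$ (i, a)) * ((lam i - \<theta> j) * (\<Sum>b<m. Z k $$ (i, b) * y b))) = 0"
        "(\<Sum>i<n. (norm (\<Sum>b<m. Z k $$ (i, b) * y b))\<^sup>2) = 1"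
        by (rule ritz_pair_coordinates[OF V VV Zc A pair[unfolded S_eq nth[OF j]] unit]) (rule that)
      have sq: "(?d k i)\<^sup>2 \<le> (\<rho>\<^sup>2) ^ k * (?d k a)\<^sup>2" if "a < i" "i < n" for a i
      proof -
        have "?d k i \<le> (\<rho> * norm (lam a)) ^ k" using \<rho>(3)[OF that] by (intro power_mono) auto
        then have "(?d k i)\<^sup>2 \<le> ((\<rho> * norm (lam a)) ^ k)\<^sup>2" by (rule power_mono) simp
        also have "\<dots> = (\<rho>\<^sup>2) ^ k * (?d k a)\<^sup>2"
          by (simp add: power_mult_distrib mult.commute flip: power_mult)
        finally show ?thesis .
      qed
      have lam_0: "norm (lam i) \<le> norm (lam 0)" if "i < n" for i
        using assms(3)[of 0 i] that by (cases "i = 0") auto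
      interpret r: perturbed_ritz_vector n m j lam "\<theta> j" "\<lambda>i b. Z k $$ (i, b)" y "?d k" g h \<delta> R "(\<rho>\<^sup>2) ^ k" C K
      proof
        show "0 < ?d k i" if "i < n" for i using lam_pos[OF that] by simp
        show "(?d k m)\<^sup>2 \<le> (\<rho>\<^sup>2) ^ k * (?d k a)\<^sup>2" if "a < m" for a using sq[of a m] that assms(2) by simp
        show "(?d k i)\<^sup>2 \<le> (\<rho>\<^sup>2) ^ k * (?d k m)\<^sup>2" if "m < i" "i < n" for i using sq that .
        show "h * (?d k i / ?d k b) \<le> norm (Z k $$ (i, b))"
          "norm (Z k $$ (i, b)) \<le> g * (?d k i / ?d k b)" if "m \<le> i" "i < n" "b < m" for i b
          using h[of "(i, b)"] g[of "(i, b)"] that unfolding Z_norm[OF that(2,3)]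
          by (intro mult_right_mono; simp)+
        \<comment> \<open>The index \<open>a = m\<close> is included since \<open>P_lower\<close>
          needs \<open>lam m\<close> to stay away from the Ritz value.\<close>
        show "\<delta> \<le> norm (lam a - \<theta> j)" if "a \<le> m" "a \<noteq> j" for a
        proof -
          have "4 * \<delta> \<le> norm (lam a - lam j)" using that j assms(2) by (intro gapn) auto
          also have "\<dots> \<le> norm (lam a - \<theta> j) + norm (lam j - \<theta> j)"
            using norm_triangle_ineq4[of "lam a - \<theta> j" "lam j - \<theta> j"] by simp
          finally show ?thesis using \<theta>[OF j] \<delta>(1) by linarith
        qed
        show "norm (lam i - \<theta> j) \<le> R" if "i < n" for i
          using norm_triangle_ineq4[of "lam i" "\<theta> j"] mod_upper[OF j] lam_0[OF that] lam_0[of j] j assms(2)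
          unfolding R_def by linarith
      qed (use assms(2) j hg \<delta>(1) Rpos \<rho>(1) Z_top y C_def K_def ev in \<open>auto simp: ev_def\<close>)
      have x: "w \<bullet>c col V i = r.x i" if "i < n" for i using y(1)[OF that] by (simp add: r.x_def)
      have xt: "w \<bullet>c col V i = y i" if "i < m" for i using x[of i] that assms(2) r.x_top by simp
      have d2: "norm (lam i) ^ (2 * k) = (?d k i)\<^sup>2" for i by (simp add: mult.commute flip: power_mult)
      have weaken: "M7 * t \<le> s \<and> s \<le> M6 * t" if "b \<le> M6" "M7 \<le> a" "a * t \<le> s" "s \<le> b * t" "0 \<le> t" for a b s t
        using that mult_right_mono[of b M6 t] mult_right_mono[of M7 a t] by linarith
      show ?thesis unfolding d2
      proof (intro conjI allI impI)
        show "M7 * ((?d k m)\<^sup>2 / (?d k i * ?d k j)) \<le> norm (w \<bullet>c col V i)"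
          "norm (w \<bullet>c col V i) \<le> M6 * ((?d k m)\<^sup>2 / (?d k i * ?d k j))" if "i < m" "i \<noteq> j" for i
          using weaken[OF M6_ge(1) M7_le(1) r.y_lower[OF that] r.y_upper'[OF that]] xt[OF that(1)] by simp_all
        show "M7 * (?d k i / ?d k j) \<le> norm (w \<bullet>c col V i)"
          "norm (w \<bullet>c col V i) \<le> M6 * (?d k i / ?d k j)" if "m \<le> i \<and> i < n" for i
          using weaken[OF M6_ge(2) M7_le(2) r.x_lower[of i] r.x_upper'[of i]] x[of i] that by simp_all
        show "M7 * ((?d k m)\<^sup>2 / (?d k j)\<^sup>2) \<le> 1 - norm (w \<bullet>c col V j)"
          "1 - norm (w \<bullet>c col V j) \<le> M6 * ((?d k m)\<^sup>2 / (?d k j)\<^sup>2)"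
          using weaken[OF M6_ge(3) M7_le(3) r.yj_defect_lower r.yj_defect_upper] xt[OF j] by simp_all
      qed
    qed
    then show ?thesis using ritz len decreasing by blast
  qed
  \<comment> \<open>\<open>Suc k0\<close> instead of \<open>k0\<close> makes the threshold
    positive.\<close>
  show ?thesis
    unfolding Let_def
    by (rule exI[of _ M6], rule conjI[OF M6pos], rule exI[of _ M7], rule conjI[OF M7pos],
        rule exI[of _ "Suc k0"], rule conjI[OF zero_less_Suc], intro allI impI, elim conjE)
      (rule bounds[OF _ _ _ _ _ _ refl refl])
qed

end
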